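(* Let $E_*=\{m+n\sqrt{-1}:(m,n)\in\mathbb{Z}\times\mathbb{Z},\ m\ge1\}$, let $\hat E\subset E_*$ be nonempty, let $J=\{z\in\mathbb{C}:|z-1/2|\le1/2\}$, and let $T_e(z)=1/(e+z)$ for $e\in E_*$. Assume: (I) $E\subset\hat E$ is a subset such that the limit set $K$ of the system $(T_e)_{e\in E}$ on $J$ has positive Hausdorff dimension. (II) For each $e\in\hat E$ and $\epsilon\in(0,1)$, $T_e(\epsilon,\cdot):J\to J$ is defined by $$T_e(\epsilon,z)=\begin{cases}T_e(z),&e\in E,\\ \dfrac{1}{e+\frac12+\epsilon(z-\frac12)},&e\in\hat E\setminus E.\end{cases}$$ (III) The number $s_0$ with $P(s_0\varphi^E)=0$ satisfies $s_0\ge0$ and $\sum_{e\in\hat E}\|T_e'\|^{s_0}<+\infty$. Let $K(\epsilon)$ be the limit set of the system $(T_e(\epsilon,\cdot))_{e\in\hat E}$ on $J$. Then $\dim_H K(\epsilon)\to\dim_H K$ as $\epsilon\to0$.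
   Context: $\dim_H$ denotes Hausdorff dimension in $\mathbb{C}\cong\mathbb{R}^2$ and $\|T_e'\|=\sup_{z\in J}|T_e'(z)|$. The directed graph underlying each system has a single vertex, so all sequences of edges are admissible. Let $F\subset\{m+n\sqrt{-1}:(m,n)\in\mathbb{Z}\times\mathbb{Z},\ m\ge1\}$ be nonempty and let $(S_e)_{e\in F}$ be a system of maps $S_e:J\to J$ such that, for a fixed $\epsilon\in(0,1)$, each $S_e$ is either $z\mapsto\frac{1}{e+z}$ or $z\mapsto\frac{1}{e+\frac12+\epsilon(z-\frac12)}$. The limit set of $(S_e)_{e\in F}$ is $\pi(F^{\mathbb{Z}_{\ge0}})$, where $\{\pi(\omega)\}=\bigcap_{k\ge0}S_{\omega_0}\circ\cdots\circ S_{\omega_k}(J)$ for $\omega=\omega_0\omega_1\cdots\in F^{\mathbb{Z}_{\ge0}}$. For the unperturbed system $(T_e)_{e\in E}$ with coding map $\pi$ and shift $\sigma$ on $E^{\mathbb{Z}_{\ge0}}$, $\varphi^E(\omega)=\log|T_{\omega_0}'(\pi(\sigma\omega))|$. The topological pressure of a real function $f$ on $E^{\mathbb{Z}_{\ge0}}$ is $P(f)=\lim_{n\to\infty}\frac1n\log\sum_{w\in E^n}\exp(\sup_{\omega\in[w]}\sum_{i=0}^{n-1}f(\sigma^i\omega))$, where $[w]$ is the set of sequences beginning with $w$. *)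

theory Defs
  imports "HOL-Analysis.Analysis"
begin

section \<open>Hausdorff dimension\<close>

text \<open>
  The summand \<open>(diam U)^s\<close> of a cover, with the conventions that the empty set contributes 0
  and that \<open>0^0 = 1\<close> (so that the 0-dimensional measure is counting measure); note that
  \<open>0 powr 0 = 0\<close> and that \<^const>\<open>diameter\<close> is only meaningful on bounded sets.
\<close>
definition hausdorff_gauge :: "real \<Rightarrow> 'a::metric_space set \<Rightarrow> ennreal" where
  "hausdorff_gauge s U =
     (if U = {} then 0 else if s = 0 then 1 else ennreal (diameter U powr s))"

definition hausdorff_premeasure :: "real \<Rightarrow> real \<Rightarrow> 'a::metric_space set \<Rightarrow> ennreal" where
  "hausdorff_premeasure s \<delta> A =
     (INF U \<in> {U :: nat \<Rightarrow> 'a set. (\<forall>i. bounded (U i) \<and> diameter (U i) \<le> \<delta>) \<and> A \<subseteq> (\<Union>i. U i)}.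
        \<Sum>i. hausdorff_gauge s (U i))"

definition hausdorff_measure :: "real \<Rightarrow> 'a::metric_space set \<Rightarrow> ennreal" where
  "hausdorff_measure s A = (SUP \<delta> \<in> {0<..}. hausdorff_premeasure s \<delta> A)"

definition hausdorff_dim :: "'a::metric_space set \<Rightarrow> ereal" where
  "hausdorff_dim A = (INF s \<in> {s. 0 \<le> s \<and> hausdorff_measure s A = 0}. ereal s)"


section \<open>Sequences, words and topological pressure\<close>

definition seqs :: "'a set \<Rightarrow> (nat \<Rightarrow> 'a) set" where
  "seqs E = {\<omega>. \<forall>i. \<omega> i \<in> E}"

definition words :: "'a set \<Rightarrow> nat \<Rightarrow> 'a list set" where
  "words E n = {w. length w = n \<and> set w \<subseteq> E}"

definition cylinder :: "'a set \<Rightarrow> 'a list \<Rightarrow> (nat \<Rightarrow> 'a) set" where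
  "cylinder E w = {\<omega> \<in> seqs E. \<forall>i < length w. \<omega> i = w ! i}"

definition shift :: "(nat \<Rightarrow> 'a) \<Rightarrow> nat \<Rightarrow> 'a" where
  "shift \<omega> = (\<lambda>i. \<omega> (Suc i))"

definition exp_ext :: "ereal \<Rightarrow> ennreal" where
  "exp_ext x = (if x = -\<infinity> then 0 else if x = \<infinity> then \<infinity> else ennreal (exp (real_of_ereal x)))"

definition ln_ext :: "ennreal \<Rightarrow> ereal" where
  "ln_ext x = (if x = 0 then -\<infinity> else if x = \<infinity> then \<infinity> else ereal (ln (enn2real x)))"

definition partition_sum :: "'a set \<Rightarrow> ((nat \<Rightarrow> 'a) \<Rightarrow> real) \<Rightarrow> nat \<Rightarrow> ennreal" where
  "partition_sum E f n =
     (\<Sum>\<^sub>\<infinity>w\<in>words E n. exp_ext (SUP \<omega>\<in>cylinder E w. ereal (\<Sum>i<n. f ((shift ^^ i) \<omega>))))"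

text \<open>
  \<open>has_pressure E f p\<close> says \<open>P(f) = p\<close>: the limit defining the pressure of \<open>f\<close> on the full shift
  over \<open>E\<close> exists in the extended reals and equals \<open>p\<close>.
\<close>
definition has_pressure :: "'a set \<Rightarrow> ((nat \<Rightarrow> 'a) \<Rightarrow> real) \<Rightarrow> ereal \<Rightarrow> bool" where
  "has_pressure E f p \<longleftrightarrow>
     (\<lambda>n. ereal (1 / real n) * ln_ext (partition_sum E f n)) \<longlonglongrightarrow> p"


section \<open>Complex continued fraction systems\<close>

definition E_star :: "complex set" where
  "E_star = {Complex (of_int m) (of_int n) | m n :: int. m \<ge> 1}"

definition disk :: "complex set" where
  "disk = {z. cmod (z - 1/2) \<le> 1/2}"

definition cf_map :: "complex \<Rightarrow> complex \<Rightarrow> complex" where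
  "cf_map e z = 1 / (e + z)"

definition cf_perturbed :: "complex set \<Rightarrow> real \<Rightarrow> complex \<Rightarrow> complex \<Rightarrow> complex" where
  "cf_perturbed E \<epsilon> e z =
     (if e \<in> E then cf_map e z else 1 / (e + 1/2 + complex_of_real \<epsilon> * (z - 1/2)))"

text \<open>\<open>word_map S [e\<^sub>0, \<dots>, e\<^sub>k] = S e\<^sub>0 \<circ> \<dots> \<circ> S e\<^sub>k\<close>.\<close>
fun word_map :: "('a \<Rightarrow> complex \<Rightarrow> complex) \<Rightarrow> 'a list \<Rightarrow> complex \<Rightarrow> complex" where
  "word_map S [] = id"
| "word_map S (e # w) = S e \<circ> word_map S w"

text \<open>
  The coding map: the unique point of the nested intersection. For sequences over \<^term>\<open>E_star\<close>
  and the maps considered here the intersection is a singleton.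
\<close>
definition coding :: "('a \<Rightarrow> complex \<Rightarrow> complex) \<Rightarrow> (nat \<Rightarrow> 'a) \<Rightarrow> complex" where
  "coding S \<omega> = the_elem (\<Inter>k. word_map S (map \<omega> [0..<Suc k]) ` disk)"

definition limit_set :: "('a \<Rightarrow> complex \<Rightarrow> complex) \<Rightarrow> 'a set \<Rightarrow> complex set" where
  "limit_set S F = coding S ` seqs F"

definition cf_potential :: "(nat \<Rightarrow> complex) \<Rightarrow> real" where
  "cf_potential \<omega> = ln (cmod (deriv (cf_map (\<omega> 0)) (coding cf_map (shift \<omega>))))"

definition cf_deriv_norm :: "complex \<Rightarrow> real" where
  "cf_deriv_norm e = (SUP z\<in>disk. cmod (deriv (cf_map e) z))"

end

theory Submission
  imports Defs "HOL-Library.Sublist"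
begin

text \<open>
  Write \<open>h\<close> for the dimension of the unperturbed limit set \<open>K\<close>. The perturbed limit set contains
  \<open>K\<close>, because the maps with symbols in \<open>E\<close> are not perturbed, so its dimension is at least \<open>h\<close>.
  For the other direction take \<open>h \<le> s < t\<close> with \<open>t\<close> close to \<open>h\<close> such that \<open>K\<close> has
  \<open>s\<close>-dimensional measure 0. It is enough to cover the perturbed limit set by cylinders whose
  diameters have small \<open>t\<close>-th powers in total.

  The perturbation contracts by an additional factor \<open>\<epsilon>\<close> whenever a symbol outside \<open>E\<close> is used.
  Hence the sum of the \<open>t\<close>-th powers of the contraction rates over all words of length \<open>n\<close> is at
  most the unperturbed sum over the words in \<open>E\<close> plus \<open>\<epsilon> powr t * C ^ n\<close>, where \<open>C\<close> bounds the sum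
  over single symbols (\<open>perturbed_word_sum_le\<close>). If the first term is small for some \<open>n\<close> and \<open>C\<close> is
  finite, the total is below 1 for small \<open>\<epsilon>\<close>, and iterating it gives measure 0
  (\<open>limit_set_null\<close>). By the summability hypothesis \<open>C\<close> is finite as soon as \<open>s\<^sub>0 \<le> t\<close>.

  Both requirements follow from one estimate, \<open>word_sum_le_of_null\<close>: if \<open>K\<close> has \<open>s\<close>-dimensional
  measure 0, the sum over words of length \<open>n\<close> at exponent \<open>s\<close> is at most \<open>4 powr s\<close>, for every
  length and every finite part of the alphabet. Two maps together contract by 1/2, so at every
  larger exponent the sums decay exponentially in \<open>n\<close>. This makes the first term small, and it
  makes the pressure negative at all exponents above \<open>s\<close>, so that \<open>s\<^sub>0 \<le> s\<close>.

  The estimate is proved without conformal measures. A finite alphabet \<open>F\<close> turns a fine cover of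
  its limit set by open balls into a finite set of words, the first cylinders along each branch
  that are no larger than a ball meeting them: cylinders of comparable size are separated
  (\<open>centres_separated\<close>), so only boundedly many of them belong to one ball, and compactness (\<open>fan\<close>)
  allows only boundedly long ones to be kept. Their total weight is at most 1, and splitting long
  words at them bounds the sums over words of any length (\<open>word_sum_bounded_of_null\<close>). That bound
  depends on \<open>F\<close>, but the sums are supermultiplicative up to the distortion constant 4, and a
  bounded supermultiplicative sequence is bounded by its constant (\<open>bounded_word_sum_le\<close>).

  The maps are Moebius transformations, so the required geometry is explicit: distances are
  governed by the geometric mean of two derivatives (\<open>cf_word_diff\<close>), and distortion by the
  position of the pole (\<open>cf_jac_pole\<close>).
\<close>

section \<open>Geometry of the disk and of a single map\<close>

lemma cmod_minus_half: "(cmod (z - 1/2))\<^sup>2 = (cmod z)\<^sup>2 - Re z + 1/4"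
  unfolding cmod_power2 by (simp add: power2_eq_square algebra_simps)

lemma in_disk_iff: "z \<in> disk \<longleftrightarrow> (cmod z)\<^sup>2 \<le> Re z"
proof -
  have "cmod (z - 1/2) \<le> 1/2 \<longleftrightarrow> (cmod (z - 1/2))\<^sup>2 \<le> (1/2)\<^sup>2"
    using abs_le_square_iff[of "cmod (z - 1/2)" "1/2"] by simp
  thus ?thesis
    unfolding cmod_minus_half by (simp add: disk_def power2_eq_square)
qed

lemma Re_disk_nonneg: "z \<in> disk \<Longrightarrow> 0 \<le> Re z"
  unfolding in_disk_iff by (rule order_trans[OF zero_le_power2])

lemma half_in_disk: "1/2 \<in> disk"
  by (simp add: disk_def)

lemma disk_eq_cball: "disk = cball (1/2) (1/2)"
  by (auto simp: disk_def dist_norm norm_minus_commute)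

lemma compact_disk: "compact disk"
  by (simp add: disk_eq_cball)

lemma dist_disk_le_1: "x \<in> disk \<Longrightarrow> y \<in> disk \<Longrightarrow> cmod (x - y) \<le> 1"
  using norm_triangle_ineq4[of "x - 1/2" "y - 1/2"] by (simp add: disk_def)

lemma Re_E_star: "e \<in> E_star \<Longrightarrow> 1 \<le> Re e"
  by (auto simp: E_star_def)

lemma Re_shift_ge_1:
  assumes "e \<in> E_star" "z \<in> disk"
  shows "1 \<le> Re (e + z)"
  using Re_E_star[OF assms(1)] Re_disk_nonneg[OF assms(2)] by simp

lemma cmod_shift_ge_1: "e \<in> E_star \<Longrightarrow> z \<in> disk \<Longrightarrow> 1 \<le> cmod (e + z)"
  using Re_shift_ge_1 complex_Re_le_cmod order_trans by blast

lemma shift_nonzero: "e \<in> E_star \<Longrightarrow> z \<in> disk \<Longrightarrow> e + z \<noteq> 0"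
  using cmod_shift_ge_1[of e z] by auto

lemma inverse_in_disk:
  assumes "1 \<le> Re u"
  shows "1 / u \<in> disk"
proof -
  have "u \<noteq> 0" using assms by auto
  hence "0 < (cmod u)\<^sup>2" by simp
  thus ?thesis using assms
    by (simp add: in_disk_iff norm_divide power_divide Re_divide cmod_power2 divide_simps)
qed

lemma cf_map_in_disk: "e \<in> E_star \<Longrightarrow> z \<in> disk \<Longrightarrow> cf_map e z \<in> disk"
  unfolding cf_map_def by (intro inverse_in_disk Re_shift_ge_1)

lemma cf_map_diff:
  assumes "e \<in> E_star" "x \<in> disk" "y \<in> disk"
  shows "cmod (cf_map e x - cf_map e y) = cmod (x - y) / (cmod (e + x) * cmod (e + y))"
proof -
  have "cf_map e x - cf_map e y = (y - x) / ((e + x) * (e + y))"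
    using assms shift_nonzero by (simp add: cf_map_def field_simps)
  thus ?thesis by (simp add: norm_divide norm_mult norm_minus_commute)
qed

text \<open>
  The single map with symbol 1 has derivative of modulus 1 at the origin, so strict contraction
  needs two steps: if the inner denominator \<open>f + z\<close> is shorter than \<open>sqrt 2\<close>, its inverse has real
  part at least 1/2, which makes the outer denominator longer than \<open>sqrt 2\<close>.
\<close>
lemma two_step_denominator:
  assumes e: "e \<in> E_star" and f: "f \<in> E_star" and z: "z \<in> disk"
  shows "2 \<le> (cmod (e + cf_map f z))\<^sup>2 * (cmod (f + z))\<^sup>2"
proof (cases "2 \<le> (cmod (f + z))\<^sup>2")
  case True
  have "1 \<le> (cmod (e + cf_map f z))\<^sup>2"
    using cmod_shift_ge_1[OF e cf_map_in_disk[OF f z]] by simp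
  thus ?thesis using True mult_mono[of 1 "(cmod (e + cf_map f z))\<^sup>2" 2 "(cmod (f + z))\<^sup>2"] by simp
next
  case False
  define u where "u = f + z"
  have u: "1 \<le> Re u" "(cmod u)\<^sup>2 < 2" "1 \<le> cmod u"
    using False Re_shift_ge_1[OF f z] cmod_shift_ge_1[OF f z] by (auto simp: u_def)
  have "1/2 \<le> Re u / (cmod u)\<^sup>2"
    using u mult_mono[of 1 "Re u" "1/2 * (cmod u)\<^sup>2" 1]
    by (subst pos_le_divide_eq) auto
  hence "1/2 \<le> Re (cf_map f z)"
    by (simp add: cf_map_def u_def Re_divide cmod_power2)
  hence "3/2 \<le> cmod (e + cf_map f z)"
    using Re_E_star[OF e] complex_Re_le_cmod[of "e + cf_map f z"] by simp
  hence "(3/2)\<^sup>2 \<le> (cmod (e + cf_map f z))\<^sup>2" by (intro power_mono) auto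
  moreover have "1 \<le> (cmod (f + z))\<^sup>2" using u by (simp add: u_def)
  ultimately show ?thesis
    using mult_mono[of "(3/2)\<^sup>2" "(cmod (e + cf_map f z))\<^sup>2" 1 "(cmod (f + z))\<^sup>2"]
    by (simp add: power2_eq_square)
qed

section \<open>Derivatives of compositions\<close>

lemma word_map_append: "word_map S (v @ w) z = word_map S v (word_map S w z)"
  by (induction v) auto

lemma word_map_in_disk:
  assumes "\<And>e. e \<in> set w \<Longrightarrow> S e ` disk \<subseteq> disk" and "z \<in> disk"
  shows "word_map S w z \<in> disk"
  using assms by (induction w) auto

lemma cf_word_in_disk: "set w \<subseteq> E_star \<Longrightarrow> z \<in> disk \<Longrightarrow> word_map cf_map w z \<in> disk"
  by (rule word_map_in_disk) (auto intro: cf_map_in_disk)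

text \<open>The modulus of the derivative of \<open>word_map cf_map w\<close> at \<open>z\<close>, by the chain rule.\<close>
fun cf_jac :: "complex list \<Rightarrow> complex \<Rightarrow> real" where
  "cf_jac [] z = 1"
| "cf_jac (e # w) z = cf_jac w z / (cmod (e + word_map cf_map w z))\<^sup>2"

definition cf_sup :: "complex list \<Rightarrow> real" where
  "cf_sup w = (SUP z\<in>disk. cf_jac w z)"

lemma cf_jac_append: "cf_jac (v @ w) z = cf_jac v (word_map cf_map w z) * cf_jac w z"
  by (induction v) (auto simp: word_map_append)

lemma cf_jac_pos: "set w \<subseteq> E_star \<Longrightarrow> z \<in> disk \<Longrightarrow> 0 < cf_jac w z"
  by (induction w) (auto simp: shift_nonzero cf_word_in_disk intro!: divide_pos_pos)

lemma cf_jac_le_1: "set w \<subseteq> E_star \<Longrightarrow> z \<in> disk \<Longrightarrow> cf_jac w z \<le> 1"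
proof (induction w)
  case (Cons e w)
  hence "1 \<le> (cmod (e + word_map cf_map w z))\<^sup>2"
    by (auto intro!: one_le_power cmod_shift_ge_1 cf_word_in_disk)
  thus ?case using Cons by (auto simp: divide_le_eq_1 intro: order_trans)
qed auto

text \<open>
  Moebius maps satisfy a mean value equality with the geometric mean of the two derivatives; it
  replaces both the mean value inequality and its converse.
\<close>
lemma cf_word_diff:
  assumes "set w \<subseteq> E_star" "x \<in> disk" "y \<in> disk"
  shows "(cmod (word_map cf_map w x - word_map cf_map w y))\<^sup>2
           = (cmod (x - y))\<^sup>2 * (cf_jac w x * cf_jac w y)"
  using assms
proof (induction w)
  case (Cons e w)
  hence "cmod (word_map cf_map (e # w) x - word_map cf_map (e # w) y)
     = cmod (word_map cf_map w x - word_map cf_map w y)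
         / (cmod (e + word_map cf_map w x) * cmod (e + word_map cf_map w y))"
    by (auto intro!: cf_map_diff cf_word_in_disk)
  thus ?case using Cons by (simp add: power_divide power_mult_distrib)
qed auto

text \<open>
  The derivative of a composition is \<open>1 / (c (z - p))\<^sup>2\<close> up to a factor of modulus 1, and
  appending a symbol \<open>e\<close> moves the pole \<open>p\<close> to \<open>1/p - e\<close>. Hence every pole stays in the half plane
  \<open>Re p \<le> -1\<close>, at distance at least 1 from the disk.
\<close>
lemma cf_jac_pole:
  assumes "set w \<subseteq> E_star" "w \<noteq> []"
  shows "\<exists>c p. 0 < c \<and> Re p \<le> -1 \<and> (\<forall>z\<in>disk. cf_jac w z = 1 / (c * cmod (z - p))\<^sup>2)"
  using assms
proof (induction w rule: rev_induct)
  case (snoc e w)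
  have e: "e \<in> E_star" using snoc by auto
  show ?case
  proof (cases "w = []")
    case True
    have "\<forall>z\<in>disk. cf_jac (w @ [e]) z = 1 / (1 * cmod (z - (- e)))\<^sup>2"
      using True by (simp add: add.commute)
    moreover have "Re (- e) \<le> -1" using Re_E_star[OF e] by simp
    ultimately show ?thesis by (intro exI[of _ 1] exI[of _ "-e"]) auto
  next
    case False
    then obtain c p where c: "0 < c" "Re p \<le> -1"
      and eq: "\<forall>z\<in>disk. cf_jac w z = 1 / (c * cmod (z - p))\<^sup>2"
      using snoc by auto
    have p0: "p \<noteq> 0" using c by auto
    have "cf_jac (w @ [e]) z = 1 / (c * cmod p * cmod (z - (1/p - e)))\<^sup>2" if z: "z \<in> disk" for z
    proof -
      have nz: "e + z \<noteq> 0" using shift_nonzero e z by auto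
      have "cf_jac (w @ [e]) z = 1 / (c * cmod (1 / (e + z) - p))\<^sup>2 / (cmod (e + z))\<^sup>2"
        using eq cf_map_in_disk[OF e z] by (simp add: cf_jac_append cf_map_def)
      also have "\<dots> = 1 / (c * (cmod (1 / (e + z) - p) * cmod (e + z)))\<^sup>2"
        by (simp add: power_mult_distrib)
      also have "cmod (1 / (e + z) - p) * cmod (e + z) = cmod p * cmod (z - (1/p - e))"
      proof -
        have "(1 / (e + z) - p) * (e + z) = - (p * (z - (1/p - e)))"
          using nz p0 by (simp add: field_simps)
        thus ?thesis by (metis norm_minus_cancel norm_mult)
      qed
      finally show ?thesis by (simp add: mult.assoc)
    qed
    moreover have "Re (1/p - e) \<le> -1"
    proof -
      have "Re (1/p) \<le> 0" using c by (simp add: Re_divide divide_nonpos_nonneg)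
      thus ?thesis using Re_E_star[OF e] by simp
    qed
    moreover have "0 < c * cmod p" using c p0 by simp
    ultimately show ?thesis by blast
  qed
qed auto

lemma cf_jac_distortion:
  assumes "set w \<subseteq> E_star" "x \<in> disk" "y \<in> disk"
  shows "cf_jac w x \<le> 4 * cf_jac w y"
proof (cases "w = []")
  case False
  then obtain c p where c: "0 < c" "Re p \<le> -1"
    and eq: "\<forall>z\<in>disk. cf_jac w z = 1 / (c * cmod (z - p))\<^sup>2"
    using cf_jac_pole assms by blast
  have far: "1 \<le> cmod (z - p)" if "z \<in> disk" for z
    using c complex_Re_le_cmod[of "z - p"] Re_disk_nonneg[OF that] by simp
  have "cmod (y - p) \<le> cmod (x - p) + cmod (y - x)"
    using norm_triangle_ineq[of "x - p" "y - x"] by simp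
  hence "cmod (y - p) \<le> 2 * cmod (x - p)"
    using far[OF assms(2)] dist_disk_le_1[OF assms(3,2)] by simp
  hence "(c * cmod (y - p))\<^sup>2 \<le> (2 * (c * cmod (x - p)))\<^sup>2"
    using c by (intro power_mono) auto
  hence le: "(c * cmod (y - p))\<^sup>2 \<le> 4 * (c * cmod (x - p))\<^sup>2"
    by (simp only: power_mult_distrib[of 2]) simp
  have pos: "0 < (c * cmod (y - p))\<^sup>2" "0 < (c * cmod (x - p))\<^sup>2"
    using c far[OF assms(2)] far[OF assms(3)] by auto
  have "1 / Y \<le> 4 * (1 / X)" if "X \<le> 4 * Y" "0 < X" "0 < Y" for X Y :: real
    using that by (simp add: field_simps)
  from this[OF le pos] have "1 / (c * cmod (x - p))\<^sup>2 \<le> 4 * (1 / (c * cmod (y - p))\<^sup>2)"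
    .
  thus ?thesis using eq assms by simp
qed simp

lemma bdd_above_cf_jac: "set w \<subseteq> E_star \<Longrightarrow> bdd_above (cf_jac w ` disk)"
  by (auto intro!: bdd_aboveI2[where M = 1] cf_jac_le_1)

lemma cf_jac_le_sup: "set w \<subseteq> E_star \<Longrightarrow> z \<in> disk \<Longrightarrow> cf_jac w z \<le> cf_sup w"
  unfolding cf_sup_def by (rule cSUP_upper[OF _ bdd_above_cf_jac])

lemma cf_sup_leI: "(\<And>z. z \<in> disk \<Longrightarrow> cf_jac w z \<le> c) \<Longrightarrow> cf_sup w \<le> c"
  unfolding cf_sup_def using half_in_disk by (intro cSUP_least) auto

lemma cf_sup_pos: "set w \<subseteq> E_star \<Longrightarrow> 0 < cf_sup w"
  using cf_jac_le_sup[OF _ half_in_disk] cf_jac_pos[OF _ half_in_disk] by (rule order.strict_trans2[rotated])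

lemma cf_sup_le_1: "set w \<subseteq> E_star \<Longrightarrow> cf_sup w \<le> 1"
  by (auto intro!: cf_sup_leI cf_jac_le_1)

lemma cf_sup_Nil: "cf_sup [] = 1"
  using half_in_disk unfolding cf_sup_def cf_jac.simps by (intro cSUP_const) auto

lemma cf_sup_le_4_jac: "set w \<subseteq> E_star \<Longrightarrow> z \<in> disk \<Longrightarrow> cf_sup w \<le> 4 * cf_jac w z"
  by (intro cf_sup_leI cf_jac_distortion)

lemma cf_sup_append_le:
  assumes "set v \<subseteq> E_star" "set w \<subseteq> E_star"
  shows "cf_sup (v @ w) \<le> cf_sup v * cf_sup w"
proof (rule cf_sup_leI)
  fix z assume z: "z \<in> disk"
  have "cf_jac v (word_map cf_map w z) * cf_jac w z \<le> cf_sup v * cf_sup w"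
    using assms z
    by (intro mult_mono cf_jac_le_sup cf_word_in_disk less_imp_le[OF cf_sup_pos]
        less_imp_le[OF cf_jac_pos]) auto
  thus "cf_jac (v @ w) z \<le> cf_sup v * cf_sup w" by (simp add: cf_jac_append)
qed

lemma cf_sup_append_ge:
  assumes "set v \<subseteq> E_star" "set w \<subseteq> E_star"
  shows "cf_sup v * cf_sup w \<le> 4 * cf_sup (v @ w)"
proof -
  have "cf_sup w \<le> 4 * cf_sup (v @ w) / cf_sup v"
  proof (rule cf_sup_leI)
    fix z assume z: "z \<in> disk"
    have "cf_sup v * cf_jac w z \<le> 4 * cf_jac v (word_map cf_map w z) * cf_jac w z"
      using assms z
      by (intro mult_right_mono cf_sup_le_4_jac cf_word_in_disk less_imp_le[OF cf_jac_pos]) auto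
    also have "\<dots> \<le> 4 * cf_sup (v @ w)"
      using cf_jac_le_sup[of "v @ w" z] assms z by (simp add: cf_jac_append)
    finally show "cf_jac w z \<le> 4 * cf_sup (v @ w) / cf_sup v"
      using cf_sup_pos[OF assms(1)] by (simp add: field_simps)
  qed
  thus ?thesis using cf_sup_pos[OF assms(1)] by (simp add: field_simps)
qed

lemma cf_sup_decay: "set w \<subseteq> E_star \<Longrightarrow> cf_sup w \<le> (1/2) ^ (length w div 2)"
proof (induction w rule: induct_list012)
  case (3 e f w)
  have "cf_sup [e, f] \<le> 1/2"
  proof (rule cf_sup_leI)
    fix z assume "z \<in> disk"
    hence "2 \<le> (cmod (e + cf_map f z))\<^sup>2 * (cmod (f + z))\<^sup>2"
      using 3 by (intro two_step_denominator) auto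
    thus "cf_jac [e, f] z \<le> 1/2" by (simp add: field_simps)
  qed
  hence "cf_sup [e, f] * cf_sup w \<le> 1/2 * (1/2) ^ (length w div 2)"
    using 3 by (intro mult_mono less_imp_le[OF cf_sup_pos]) auto
  thus ?case using cf_sup_append_le[of "[e, f]" w] 3 by simp
qed (auto simp: cf_sup_Nil cf_sup_le_1)

lemma cf_word_lipschitz:
  assumes "set w \<subseteq> E_star" "x \<in> disk" "y \<in> disk"
  shows "cmod (word_map cf_map w x - word_map cf_map w y) \<le> cf_sup w * cmod (x - y)"
proof (rule power2_le_imp_le)
  have "cf_jac w x * cf_jac w y \<le> cf_sup w * cf_sup w"
    using assms by (intro mult_mono cf_jac_le_sup less_imp_le[OF cf_sup_pos] less_imp_le[OF cf_jac_pos])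
  thus "(cmod (word_map cf_map w x - word_map cf_map w y))\<^sup>2 \<le> (cf_sup w * cmod (x - y))\<^sup>2"
    unfolding cf_word_diff[OF assms]
    unfolding power_mult_distrib power2_eq_square[of "cf_sup w"]
    by (subst mult.commute) (intro mult_right_mono zero_le_power2)
  show "0 \<le> cf_sup w * cmod (x - y)" using cf_sup_pos[OF assms(1)] by simp
qed

lemma cf_deriv_norm_eq:
  assumes "e \<in> E_star"
  shows "cf_deriv_norm e = cf_sup [e]"
    and "z \<in> disk \<Longrightarrow> cmod (deriv (cf_map e) z) = cf_jac [e] z"
proof -
  have *: "cmod (deriv (cf_map e) z) = cf_jac [e] z" if "z \<in> disk" for z
  proof -
    have "(cf_map e has_field_derivative - 1 / (e + z)\<^sup>2) (at z)"
      unfolding cf_map_def using shift_nonzero[OF assms that]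
      by (auto intro!: derivative_eq_intros simp: power2_eq_square)
    thus ?thesis by (simp add: DERIV_imp_deriv norm_divide norm_power)
  qed
  thus "cf_deriv_norm e = cf_sup [e]"
    unfolding cf_deriv_norm_def cf_sup_def by (intro SUP_cong) auto
  show "z \<in> disk \<Longrightarrow> cmod (deriv (cf_map e) z) = cf_jac [e] z" by (rule *)
qed

section \<open>Separation of cylinders\<close>

text \<open>
  A polynomial substitute for the distance of \<open>z\<close> to the boundary of the disk, equal to
  \<open>1/4 - |z - 1/2|\<^sup>2\<close>.
\<close>
definition disk_gap :: "complex \<Rightarrow> real" where
  "disk_gap z = Re z - (cmod z)\<^sup>2"

lemma disk_gap_le: "z \<in> disk \<Longrightarrow> cmod (z - 1/2) \<le> 1/2 - disk_gap z"
proof -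
  assume z: "z \<in> disk"
  have "disk_gap z = (1/2 - cmod (z - 1/2)) * (1/2 + cmod (z - 1/2))"
    using cmod_minus_half[of z] by (simp add: disk_gap_def power2_eq_square algebra_simps)
  also have "\<dots> \<le> (1/2 - cmod (z - 1/2)) * 1"
    using z by (intro mult_left_mono) (auto simp: disk_def)
  finally show ?thesis by simp
qed

text \<open>
  Maps decrease the gap by no more than their derivative because \<open>1/u\<close> has gap
  \<open>(Re u - 1) / |u|\<^sup>2\<close> and the real part of a point is at least its gap.
\<close>
lemma disk_gap_word:
  assumes "set w \<subseteq> E_star" "z \<in> disk"
  shows "disk_gap z * cf_jac w z \<le> disk_gap (word_map cf_map w z)"
  using assms
proof (induction w)
  case (Cons e w)
  define u where "u = word_map cf_map w z"
  have u: "u \<in> disk" "e \<in> E_star" using Cons cf_word_in_disk by (auto simp: u_def)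
  have pos: "0 < (cmod (e + u))\<^sup>2" using shift_nonzero u by simp
  have le: "disk_gap u \<le> Re (e + u) - 1"
    using Re_E_star[OF u(2)] zero_le_power2[of "cmod u"]
    unfolding disk_gap_def plus_complex.sel by linarith
  have "disk_gap z * cf_jac (e # w) z \<le> disk_gap u / (cmod (e + u))\<^sup>2"
    using Cons pos by (simp add: u_def divide_right_mono)
  also have "\<dots> \<le> (Re (e + u) - 1) / (cmod (e + u))\<^sup>2"
    using le by (intro divide_right_mono) auto
  also have "\<dots> = disk_gap (cf_map e u)"
    by (simp add: disk_gap_def cf_map_def Re_divide norm_divide power_divide cmod_power2
        diff_divide_distrib)
  finally show ?case by (simp add: u_def)
qed auto

lemma E_star_separated:
  assumes "e \<in> E_star" "f \<in> E_star" "e \<noteq> f"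
  shows "1 \<le> cmod (e - f)"
proof -
  obtain a b c d :: int where e: "e = Complex (of_int a) (of_int b)"
    and f: "f = Complex (of_int c) (of_int d)"
    using assms by (auto simp: E_star_def)
  have "a \<noteq> c \<or> b \<noteq> d" using assms e f by auto
  hence "1 \<le> \<bar>Re (e - f)\<bar> \<or> 1 \<le> \<bar>Im (e - f)\<bar>" using e f by auto
  thus ?thesis using abs_Re_le_cmod[of "e - f"] abs_Im_le_cmod[of "e - f"] by linarith
qed

lemma shifted_disks_separated:
  assumes "e \<in> E_star" "f \<in> E_star" "e \<noteq> f" "p \<in> disk" "q \<in> disk"
  shows "disk_gap p + disk_gap q \<le> cmod ((e + p) - (f + q))"
proof -
  have "cmod (e - f) \<le> cmod ((e + p) - (f + q)) + cmod ((q - 1/2) - (p - 1/2))"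
    using norm_triangle_ineq[of "(e + p) - (f + q)" "(q - 1/2) - (p - 1/2)"] by simp
  also have "cmod ((q - 1/2) - (p - 1/2)) \<le> cmod (q - 1/2) + cmod (p - 1/2)"
    by (rule norm_triangle_ineq4)
  finally show ?thesis
    using disk_gap_le[of p] disk_gap_le[of q] E_star_separated[of e f] assms by linarith
qed

text \<open>
  The open set condition in quantitative form: the images of the centre under two incomparable
  compositions are as far apart as the two image disks are large. At the first place where the
  words differ, the two points lie in different unit translates of the disk; the product form of
  the bound comes from \<open>a + b \<ge> 2 sqrt (a b)\<close>.
\<close>
lemma centres_separated:
  assumes "set w \<subseteq> E_star" "set v \<subseteq> E_star" "w \<parallel> v"
  shows "cf_jac w (1/2) * cf_jac v (1/2)
           \<le> 4 * (cmod (word_map cf_map w (1/2) - word_map cf_map v (1/2)))\<^sup>2"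
proof -
  obtain u e f w' v' where w: "w = u @ e # w'" and v: "v = u @ f # v'" and ef: "e \<noteq> f"
    using parallel_decomp[OF assms(3)] by blast
  define p q where "p = word_map cf_map w' (1/2)" and "q = word_map cf_map v' (1/2)"
  define a b where "a = cf_jac w' (1/2)" and "b = cf_jac v' (1/2)"
  define P Q where "P = cf_map e p" and "Q = cf_map f q"
  have mem: "e \<in> E_star" "f \<in> E_star" "set u \<subseteq> E_star" "set w' \<subseteq> E_star" "set v' \<subseteq> E_star"
    using assms w v by auto
  have pq: "p \<in> disk" "q \<in> disk" using mem half_in_disk by (auto simp: p_def q_def intro!: cf_word_in_disk)
  have PQ: "P \<in> disk" "Q \<in> disk" using mem pq by (auto simp: P_def Q_def intro!: cf_map_in_disk)
  have ab: "0 < a" "0 < b" using mem half_in_disk by (auto simp: a_def b_def intro!: cf_jac_pos)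
  have gap: "a / 4 \<le> disk_gap p" "b / 4 \<le> disk_gap q"
    using disk_gap_word[OF mem(4) half_in_disk] disk_gap_word[OF mem(5) half_in_disk]
    by (simp_all add: p_def q_def a_def b_def disk_gap_def power2_eq_square)
  define A B where "A = (cmod (e + p))\<^sup>2" and "B = (cmod (f + q))\<^sup>2"
  have AB: "0 < A" "0 < B" using mem pq shift_nonzero by (auto simp: A_def B_def)
  have "a * b / 4 \<le> ((a + b) / 4)\<^sup>2"
    using zero_le_power2[of "a - b"] by (simp add: power2_eq_square field_simps del: zero_le_power2)
  also have "\<dots> \<le> (cmod ((e + p) - (f + q)))\<^sup>2"
    using shifted_disks_separated[OF mem(1,2) ef pq] gap ab by (intro power_mono) auto
  finally have "a * b / 4 / (A * B) \<le> (cmod ((e + p) - (f + q)))\<^sup>2 / (A * B)"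
    using AB by (intro divide_right_mono) auto
  also have "\<dots> = (cmod (P - Q))\<^sup>2"
  proof -
    have "P - Q = ((f + q) - (e + p)) / ((e + p) * (f + q))"
      using shift_nonzero mem pq by (simp add: P_def Q_def cf_map_def field_simps)
    thus ?thesis
      by (simp add: A_def B_def norm_divide norm_mult power_divide power_mult_distrib
          norm_minus_commute)
  qed
  finally have "a / A * (b / B) * (cf_jac u P * cf_jac u Q)
      \<le> 4 * (cmod (P - Q))\<^sup>2 * (cf_jac u P * cf_jac u Q)"
    using cf_jac_pos[OF mem(3) PQ(1)] cf_jac_pos[OF mem(3) PQ(2)]
    by (intro mult_right_mono) auto
  thus ?thesis
    unfolding w v cf_jac_append word_map_append
    using cf_word_diff[OF mem(3) PQ]
    by (simp add: P_def Q_def p_def q_def a_def b_def A_def B_def mult_ac)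
qed

section \<open>Coding of limit points\<close>

text \<open>
  The contraction rate is the one of the unperturbed system, where only every second step is
  guaranteed to contract.
\<close>
definition contractive :: "('a \<Rightarrow> complex \<Rightarrow> complex) \<Rightarrow> 'a set \<Rightarrow> bool" where
  "contractive S F \<longleftrightarrow> (\<forall>e\<in>F. S e ` disk \<subseteq> disk) \<and>
     (\<forall>w x y. set w \<subseteq> F \<longrightarrow> x \<in> disk \<longrightarrow> y \<in> disk \<longrightarrow>
        cmod (word_map S w x - word_map S w y) \<le> (1/2) ^ (length w div 2) * cmod (x - y))"

lemma contractiveD:
  assumes "contractive S F"
  shows "e \<in> F \<Longrightarrow> S e ` disk \<subseteq> disk"
    and "set w \<subseteq> F \<Longrightarrow> x \<in> disk \<Longrightarrow> y \<in> disk \<Longrightarrow>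
           cmod (word_map S w x - word_map S w y) \<le> (1/2) ^ (length w div 2) * cmod (x - y)"
  using assms by (auto simp: contractive_def)

lemma contractive_cf_map: "contractive cf_map E_star"
  unfolding contractive_def
  by (auto intro: cf_map_in_disk intro!: order_trans[OF cf_word_lipschitz] mult_right_mono cf_sup_decay)

lemma contractive_subset: "contractive S F \<Longrightarrow> G \<subseteq> F \<Longrightarrow> contractive S G"
  unfolding contractive_def by (meson subset_iff)

lemma set_prefix_seqs: "\<omega> \<in> seqs F \<Longrightarrow> set (map \<omega> [0..<n]) \<subseteq> F"
  by (auto simp: seqs_def)

lemma shift_seqs: "\<omega> \<in> seqs F \<Longrightarrow> shift \<omega> \<in> seqs F"
  by (simp add: seqs_def shift_def)

lemma shift_funpow_seqs: "\<omega> \<in> seqs F \<Longrightarrow> (shift ^^ n) \<omega> \<in> seqs F"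
  by (induction n) (auto intro: shift_seqs)

lemma coding_in_cylinders:
  assumes S: "contractive S F" and \<omega>: "\<omega> \<in> seqs F"
  shows "(\<Inter>k. word_map S (map \<omega> [0..<Suc k]) ` disk) = {coding S \<omega>}"
proof -
  define D where "D n = word_map S (map \<omega> [0..<n]) ` disk" for n
  have "D (Suc n) \<subseteq> D n" for n
  proof -
    have "S (\<omega> n) ` disk \<subseteq> disk" using contractiveD(1)[OF S] \<omega> by (auto simp: seqs_def)
    thus ?thesis by (auto simp: D_def word_map_append)
  qed
  hence dec: "D n \<subseteq> D m" if "m \<le> n" for m n
    using that by (rule lift_Suc_antimono_le)
  have "compact (D n)" for n
  proof -
    have "1-lipschitz_on disk (word_map S (map \<omega> [0..<n]))"
    proof (rule lipschitz_onI)
      fix x y assume xy: "x \<in> disk" "y \<in> disk"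
      have "cmod (word_map S (map \<omega> [0..<n]) x - word_map S (map \<omega> [0..<n]) y)
              \<le> (1/2) ^ (length (map \<omega> [0..<n]) div 2) * cmod (x - y)"
        using contractiveD(2)[OF S set_prefix_seqs[OF \<omega>] xy] .
      also have "\<dots> \<le> 1 * cmod (x - y)"
        by (intro mult_right_mono power_le_one) auto
      finally show "dist (word_map S (map \<omega> [0..<n]) x) (word_map S (map \<omega> [0..<n]) y) \<le> 1 * dist x y"
        by (simp add: dist_norm)
    qed auto
    thus ?thesis
      unfolding D_def by (intro compact_continuous_image compact_disk lipschitz_on_continuous_on)
  qed
  moreover have "D n \<noteq> {}" for n using half_in_disk by (auto simp: D_def)
  ultimately have "\<Inter> (range D) \<noteq> {}" using dec by (intro compact_nest)
  moreover have sub: "(\<Inter>k. D (Suc k)) = \<Inter> (range D)"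
  proof
    show "(\<Inter>k. D (Suc k)) \<subseteq> \<Inter> (range D)"
    proof
      fix z assume "z \<in> (\<Inter>k. D (Suc k))"
      hence "z \<in> D n" for n using dec[of n "Suc n"] by auto
      thus "z \<in> \<Inter> (range D)" by blast
    qed
  qed blast
  ultimately obtain z where z: "\<forall>k. z \<in> D (Suc k)" by blast
  have "y = z" if y: "\<forall>k. y \<in> D (Suc k)" for y
  proof -
    have "cmod (y - z) \<le> (1/2) ^ n" for n
    proof -
      have "y \<in> D (2 * n)" "z \<in> D (2 * n)"
        using y z dec[of "2 * n" "Suc (2 * n)"] by auto
      then obtain a b where ab: "a \<in> disk" "b \<in> disk" "y = word_map S (map \<omega> [0..<2*n]) a"
        "z = word_map S (map \<omega> [0..<2*n]) b" by (auto simp: D_def)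
      have "cmod (y - z) \<le> (1/2) ^ n * cmod (a - b)"
        using contractiveD(2)[OF S set_prefix_seqs[OF \<omega>, of "2*n"] ab(1,2)] ab(3,4) by simp
      also have "\<dots> \<le> (1/2) ^ n * 1"
        using dist_disk_le_1 ab by (intro mult_left_mono) auto
      finally show ?thesis by simp
    qed
    moreover have "(\<lambda>n. (1/2::real) ^ n) \<longlonglongrightarrow> 0" by (rule LIMSEQ_power_zero) simp
    ultimately have "cmod (y - z) \<le> 0" by (intro LIMSEQ_le_const) auto
    thus ?thesis by simp
  qed
  hence "(\<Inter>k. D (Suc k)) = {z}" using z by blast
  moreover from this have "coding S \<omega> = z" by (simp add: coding_def D_def)
  ultimately show ?thesis by (simp add: D_def)
qed

lemma coding_in_disk:
  assumes "contractive S F" "\<omega> \<in> seqs F"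
  shows "coding S \<omega> \<in> disk"
proof -
  have "coding S \<omega> \<in> word_map S (map \<omega> [0..<Suc 0]) ` disk"
    using coding_in_cylinders[OF assms] by blast
  moreover have "S (\<omega> 0) ` disk \<subseteq> disk"
    using contractiveD(1)[OF assms(1)] assms(2) by (auto simp: seqs_def)
  ultimately show ?thesis by (simp add: subset_iff image_iff)
qed

lemma coding_shift:
  assumes "contractive S F" "\<omega> \<in> seqs F"
  shows "coding S \<omega> = S (\<omega> 0) (coding S (shift \<omega>))"
proof -
  note sh = shift_seqs[OF assms(2)]
  have "S (\<omega> 0) (coding S (shift \<omega>)) \<in> word_map S (map \<omega> [0..<Suc k]) ` disk" for k
  proof (cases k)
    case 0
    thus ?thesis using coding_in_disk[OF assms(1) sh] by simp
  next
    case (Suc j)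
    have "coding S (shift \<omega>) \<in> word_map S (map (shift \<omega>) [0..<Suc j]) ` disk"
      using coding_in_cylinders[OF assms(1) sh] by blast
    moreover have "map \<omega> [0..<Suc k] = \<omega> 0 # map (shift \<omega>) [0..<Suc j]"
      unfolding Suc shift_def by (rule map_upt_Suc)
    ultimately show ?thesis
      by (simp only: word_map.simps image_comp[symmetric] imageI)
  qed
  hence "S (\<omega> 0) (coding S (shift \<omega>)) \<in> (\<Inter>k. word_map S (map \<omega> [0..<Suc k]) ` disk)"
    by (rule INT_I)
  thus ?thesis unfolding coding_in_cylinders[OF assms] by simp
qed

lemma coding_eq_word_map:
  assumes "contractive S F" "\<omega> \<in> seqs F"
  shows "coding S \<omega> = word_map S (map \<omega> [0..<n]) (coding S ((shift ^^ n) \<omega>))"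
  using assms(2)
proof (induction n arbitrary: \<omega>)
  case (Suc n)
  have eq: "map \<omega> [0..<Suc n] = \<omega> 0 # map (shift \<omega>) [0..<n]"
    unfolding map_upt_Suc shift_def by simp
  show ?case
    unfolding eq funpow_Suc_right comp_def word_map.simps
    using Suc.IH[OF shift_seqs[OF Suc.prems]] coding_shift[OF assms(1) Suc.prems] by simp
qed simp

lemma birkhoff_sum_eq_ln_jac:
  assumes "\<omega> \<in> seqs E_star"
  shows "(\<Sum>i<n. cf_potential ((shift ^^ i) \<omega>))
           = ln (cf_jac (map \<omega> [0..<n]) (coding cf_map ((shift ^^ n) \<omega>)))"
  using assms
proof (induction n arbitrary: \<omega>)
  case (Suc n)
  define z where "z = coding cf_map ((shift ^^ n) (shift \<omega>))"
  note sh = shift_seqs[OF Suc.prems]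
  have z: "z \<in> disk"
    unfolding z_def by (intro coding_in_disk[OF contractive_cf_map] shift_funpow_seqs sh)
  have c: "coding cf_map (shift \<omega>) = word_map cf_map (map (shift \<omega>) [0..<n]) z"
    unfolding z_def by (rule coding_eq_word_map[OF contractive_cf_map sh])
  have c_disk: "coding cf_map (shift \<omega>) \<in> disk" by (rule coding_in_disk[OF contractive_cf_map sh])
  have \<omega>0: "\<omega> 0 \<in> E_star" using Suc.prems by (simp add: seqs_def)
  have eq: "map \<omega> [0..<Suc n] = \<omega> 0 # map (shift \<omega>) [0..<n]"
    unfolding map_upt_Suc shift_def by simp
  have "(\<Sum>i<Suc n. cf_potential ((shift ^^ i) \<omega>))
          = cf_potential \<omega> + (\<Sum>i<n. cf_potential ((shift ^^ i) (shift \<omega>)))"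
    unfolding sum.lessThan_Suc_shift funpow_Suc_right by simp
  also have "\<dots> = ln (1 / (cmod (\<omega> 0 + coding cf_map (shift \<omega>)))\<^sup>2)
                   + ln (cf_jac (map (shift \<omega>) [0..<n]) z)"
    using Suc.IH[OF sh] cf_deriv_norm_eq(2)[OF \<omega>0 c_disk] by (simp add: cf_potential_def z_def)
  also have "\<dots> = ln (1 / (cmod (\<omega> 0 + coding cf_map (shift \<omega>)))\<^sup>2 * cf_jac (map (shift \<omega>) [0..<n]) z)"
    using shift_nonzero[OF \<omega>0 c_disk] cf_jac_pos[OF set_prefix_seqs[OF sh] z]
    by (intro ln_mult_pos[symmetric]) auto
  finally show ?case
    unfolding eq funpow_Suc_right comp_def cf_jac.simps z_def[symmetric] by (simp add: c)
qed simp

section \<open>Hausdorff measure and dimension\<close>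

lemma hausdorff_dim_le: "0 \<le> t \<Longrightarrow> hausdorff_measure t A = 0 \<Longrightarrow> hausdorff_dim A \<le> ereal t"
  unfolding hausdorff_dim_def by (rule INF_lower) simp

lemma hausdorff_measure_mono:
  assumes "A \<subseteq> B"
  shows "hausdorff_measure s A \<le> hausdorff_measure s B"
  unfolding hausdorff_measure_def hausdorff_premeasure_def
  using assms by (intro SUP_mono' INF_superset_mono) auto

lemma hausdorff_measure_zero_mono:
  "A \<subseteq> B \<Longrightarrow> hausdorff_measure s B = 0 \<Longrightarrow> hausdorff_measure s A = 0"
  using hausdorff_measure_mono[of A B s] by simp

lemma hausdorff_dim_mono: "A \<subseteq> B \<Longrightarrow> hausdorff_dim A \<le> hausdorff_dim B"
  unfolding hausdorff_dim_def
  by (intro INF_superset_mono) (auto intro: hausdorff_measure_zero_mono)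

lemma hausdorff_gauge_pos: "0 < s \<Longrightarrow> hausdorff_gauge s U = ennreal (diameter U powr s)"
  by (simp add: hausdorff_gauge_def diameter_def)

text \<open>
  A set of measure zero is covered by open balls whose radii are as small in \<open>s\<close>-th powers as
  desired. The diameters of a cover are enlarged by a geometric series, since they may be zero.
\<close>
lemma hausdorff_measure_zero_balls:
  fixes A :: "'a::metric_space set"
  assumes "hausdorff_measure s A = 0" "0 < s" "0 < \<eta>"
  obtains x :: "nat \<Rightarrow> 'a" and r :: "nat \<Rightarrow> real"
  where "A \<subseteq> (\<Union>i. ball (x i) (r i))" "\<And>i. 0 < r i"
    "\<And>X. finite X \<Longrightarrow> (\<Sum>i\<in>X. r i powr s) \<le> \<eta>"
proof -
  have "hausdorff_premeasure s 1 A \<le> hausdorff_measure s A"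
    unfolding hausdorff_measure_def by (rule SUP_upper) simp
  hence "hausdorff_premeasure s 1 A < ennreal (\<eta>/2)" using assms by simp
  then obtain U :: "nat \<Rightarrow> 'a set" where bdd: "\<And>i. bounded (U i)" and cov: "A \<subseteq> (\<Union>i. U i)"
    and sm: "(\<Sum>i. hausdorff_gauge s (U i)) < ennreal (\<eta>/2)"
    unfolding hausdorff_premeasure_def INF_less_iff by auto
  define d where "d i = diameter (U i)" for i
  define r where "r i = (d i powr s + \<eta>/2 * (1/2) ^ Suc i) powr (1/s)" for i
  define x where "x i = (SOME y. y \<in> U i)" for i
  have d0: "0 \<le> d i" for i unfolding d_def by (intro diameter_ge_0 bdd)
  have pos: "0 < d i powr s + \<eta>/2 * (1/2) ^ Suc i" for i
    using assms by (intro add_nonneg_pos) auto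
  have rs: "r i powr s = d i powr s + \<eta>/2 * (1/2) ^ Suc i" for i
    using pos[of i] assms by (simp add: r_def powr_powr)
  have r0: "0 < r i" for i unfolding r_def using pos[of i] by (subst powr_gt_zero) linarith
  have dr: "d i < r i" for i
  proof (rule ccontr)
    assume "\<not> d i < r i"
    hence "r i powr s \<le> d i powr s" using r0[of i] assms by (intro powr_mono2) auto
    moreover have "0 < \<eta>/2 * (1/2) ^ Suc i" using assms by simp
    ultimately show False unfolding rs by linarith
  qed
  have "A \<subseteq> (\<Union>i. ball (x i) (r i))"
  proof
    fix a assume "a \<in> A"
    then obtain i where i: "a \<in> U i" using cov by auto
    hence "x i \<in> U i" unfolding x_def by (rule someI)
    hence "dist (x i) a \<le> d i" unfolding d_def using i bdd by (intro diameter_bounded_bound)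
    thus "a \<in> (\<Union>i. ball (x i) (r i))" using dr[of i] by (intro UN_I[of i]) auto
  qed
  moreover have "(\<Sum>i\<in>X. r i powr s) \<le> \<eta>" if X: "finite X" for X
  proof -
    have "ennreal (\<Sum>i\<in>X. d i powr s) = (\<Sum>i\<in>X. hausdorff_gauge s (U i))"
      using assms by (simp add: hausdorff_gauge_pos d_def)
    also have "\<dots> \<le> (\<Sum>i. hausdorff_gauge s (U i))"
      by (intro sum_le_suminf X) auto
    also have "\<dots> \<le> ennreal (\<eta>/2)" using sm by simp
    finally have 1: "(\<Sum>i\<in>X. d i powr s) \<le> \<eta>/2" using assms by (simp add: ennreal_le_iff)
    have "(\<Sum>i\<in>X. (1/2::real) ^ Suc i) \<le> (\<Sum>i. (1/2) ^ Suc i)"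
      using power_half_series by (intro sum_le_suminf X) (auto simp: sums_iff)
    hence "(\<Sum>i\<in>X. (1/2::real) ^ Suc i) \<le> 1"
      using power_half_series by (simp add: sums_iff)
    hence "\<eta>/2 * (\<Sum>i\<in>X. (1/2::real) ^ Suc i) \<le> \<eta>/2 * 1"
      using assms by (intro mult_left_mono) auto
    thus ?thesis using 1 unfolding rs sum.distrib sum_distrib_left[symmetric] by linarith
  qed
  ultimately show ?thesis using that r0 by blast
qed

text \<open>
  Covers indexed by words come with bounds on finite partial sums only; this is enough.
\<close>
lemma hausdorff_measure_zeroI:
  fixes A :: "'a::metric_space set" and U :: "real \<Rightarrow> 'i \<Rightarrow> 'a set"
  assumes t: "0 < t"
    and I: "\<And>\<eta>. 0 < \<eta> \<Longrightarrow> countable (I \<eta>)"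
    and U: "\<And>\<eta> i. 0 < \<eta> \<Longrightarrow> i \<in> I \<eta> \<Longrightarrow> bounded (U \<eta> i) \<and> diameter (U \<eta> i) \<le> g \<eta> i"
    and cov: "\<And>\<eta>. 0 < \<eta> \<Longrightarrow> A \<subseteq> (\<Union>i\<in>I \<eta>. U \<eta> i)"
    and g: "\<And>\<eta> X. 0 < \<eta> \<Longrightarrow> finite X \<Longrightarrow> X \<subseteq> I \<eta> \<Longrightarrow> (\<Sum>i\<in>X. g \<eta> i powr t) \<le> \<eta>"
  shows "hausdorff_measure t A = 0"
proof -
  have "hausdorff_premeasure t \<delta> A \<le> ennreal e" if \<delta>: "0 < \<delta>" and e: "0 < e" for \<delta> e
  proof -
    \<comment> \<open>a single summand below \<open>\<delta> powr t\<close> already bounds the diameter by \<open>\<delta>\<close>\<close>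
    define \<eta> where "\<eta> = min e (\<delta> powr t)"
    have \<eta>: "0 < \<eta>" "\<eta> \<le> e" "\<eta> \<le> \<delta> powr t" using \<delta> e by (auto simp: \<eta>_def)
    define h where "h = to_nat_on (I \<eta>)"
    have inj: "inj_on h (I \<eta>)" unfolding h_def by (rule inj_on_to_nat_on[OF I[OF \<eta>(1)]])
    define V where "V n = (if n \<in> h ` I \<eta> then U \<eta> (inv_into (I \<eta>) h n) else {})" for n
    have V: "V (h i) = U \<eta> i" if "i \<in> I \<eta>" for i
      using that inj by (simp add: V_def)
    have small: "g \<eta> i \<le> \<delta>" if i: "i \<in> I \<eta>" for i
    proof (rule ccontr)
      assume "\<not> g \<eta> i \<le> \<delta>"
      hence "\<delta> powr t < g \<eta> i powr t" using \<delta> t by (intro powr_less_mono2) auto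
      thus False using g[OF \<eta>(1), of "{i}"] i \<eta> by simp
    qed
    have "bounded (V n) \<and> diameter (V n) \<le> \<delta>" for n
    proof (cases "n \<in> h ` I \<eta>")
      case True
      then obtain i where "i \<in> I \<eta>" "n = h i" by auto
      thus ?thesis using V U[OF \<eta>(1)] small order_trans by metis
    next
      case False
      thus ?thesis using \<delta> by (simp add: V_def)
    qed
    moreover have "A \<subseteq> (\<Union>n. V n)"
    proof
      fix a assume "a \<in> A"
      then obtain i where "i \<in> I \<eta>" "a \<in> U \<eta> i" using cov[OF \<eta>(1)] by auto
      hence "a \<in> V (h i)" using V by simp
      thus "a \<in> (\<Union>n. V n)" by blast
    qed
    ultimately have "hausdorff_premeasure t \<delta> A \<le> (\<Sum>n. hausdorff_gauge t (V n))"
      unfolding hausdorff_premeasure_def by (intro INF_lower) auto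
    also have "\<dots> \<le> ennreal e"
    proof (rule suminf_le_const[OF summableI])
      fix N
      define X where "X = {i \<in> I \<eta>. h i < N}"
      have hX: "h ` X = {n. n < N \<and> n \<in> h ` I \<eta>}" by (auto simp: X_def)
      have injX: "inj_on h X" using inj by (rule inj_on_subset) (auto simp: X_def)
      have finX: "finite X" using injX hX by (metis finite_Collect_conjI finite_Collect_less_nat finite_imageD)
      have XI: "X \<subseteq> I \<eta>" by (auto simp: X_def)
      have "(\<Sum>n<N. hausdorff_gauge t (V n)) = (\<Sum>n\<in>h ` X. hausdorff_gauge t (V n))"
        unfolding hX by (intro sum.mono_neutral_right) (auto simp: V_def hausdorff_gauge_def)
      also have "\<dots> = (\<Sum>i\<in>X. ennreal (diameter (U \<eta> i) powr t))"
        unfolding sum.reindex[OF injX] using V XI t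
        by (intro sum.cong) (auto simp: hausdorff_gauge_pos)
      also have "\<dots> \<le> (\<Sum>i\<in>X. ennreal (g \<eta> i powr t))"
        using U[OF \<eta>(1)] XI t
        by (intro sum_mono ennreal_leI powr_mono2) (auto intro!: diameter_ge_0)
      also have "\<dots> = ennreal (\<Sum>i\<in>X. g \<eta> i powr t)" by simp
      also have "\<dots> \<le> ennreal e"
        using g[OF \<eta>(1) finX XI] \<eta>(2) by (intro ennreal_leI) linarith
      finally show "(\<Sum>n<N. hausdorff_gauge t (V n)) \<le> ennreal e" .
    qed
    finally show ?thesis .
  qed
  hence "hausdorff_premeasure t \<delta> A = 0" if "0 < \<delta>" for \<delta>
  proof -
    have "hausdorff_premeasure t \<delta> A \<le> 0"
      by (rule ennreal_le_epsilon) (use \<open>\<And>\<delta> e. 0 < \<delta> \<Longrightarrow> 0 < e \<Longrightarrow> _\<close> that in simp)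
    thus ?thesis by simp
  qed
  thus ?thesis by (simp add: hausdorff_measure_def SUP_eq_const)
qed

section \<open>Sums over words\<close>

lemma finite_words: "finite F \<Longrightarrow> finite (words F n)"
  using finite_lists_length_eq[of F n] by (simp add: words_def conj_commute)

lemma words_0: "words F 0 = {[]}"
  by (auto simp: words_def)

lemma words_mono: "F \<subseteq> G \<Longrightarrow> words F n \<subseteq> words G n"
  by (auto simp: words_def)

lemma words_set: "w \<in> words F n \<Longrightarrow> set w \<subseteq> F"
  by (simp add: words_def)

lemma sum_words_add:
  fixes f g :: "'a list \<Rightarrow> real"
  shows "(\<Sum>w\<in>words F (m + n). f (take m w) * g (drop m w))
           = (\<Sum>u\<in>words F m. f u) * (\<Sum>v\<in>words F n. g v)"
proof -
  have "(\<Sum>u\<in>words F m. f u) * (\<Sum>v\<in>words F n. g v)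
          = (\<Sum>(u, v)\<in>words F m \<times> words F n. f u * g v)"
    by (simp add: sum_product sum.cartesian_product)
  also have "\<dots> = (\<Sum>w\<in>words F (m + n). f (take m w) * g (drop m w))"
    by (rule sum.reindex_bij_witness[where j = "\<lambda>(u, v). u @ v" and i = "\<lambda>w. (take m w, drop m w)"])
       (auto simp: words_def dest: in_set_takeD in_set_dropD)
  finally show ?thesis by simp
qed

definition word_sum :: "complex set \<Rightarrow> nat \<Rightarrow> real \<Rightarrow> real" where
  "word_sum F n s = (\<Sum>w\<in>words F n. cf_sup w powr s)"

lemma word_sum_nonneg: "0 \<le> word_sum F n s"
  by (auto simp: word_sum_def intro: sum_nonneg)

lemma word_sum_supermultiplicative:
  assumes "finite F" "F \<subseteq> E_star" "0 \<le> s"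
  shows "word_sum F m s * word_sum F n s \<le> 4 powr s * word_sum F (m + n) s"
proof -
  have "word_sum F m s * word_sum F n s
          = (\<Sum>w\<in>words F (m + n). cf_sup (take m w) powr s * cf_sup (drop m w) powr s)"
    unfolding word_sum_def by (rule sum_words_add[symmetric])
  also have "\<dots> \<le> (\<Sum>w\<in>words F (m + n). 4 powr s * cf_sup w powr s)"
  proof (rule sum_mono)
    fix w assume "w \<in> words F (m + n)"
    hence sub: "set (take m w) \<subseteq> E_star" "set (drop m w) \<subseteq> E_star" "set w \<subseteq> E_star"
      using assms by (auto simp: words_def dest: in_set_takeD in_set_dropD)
    have "(cf_sup (take m w) * cf_sup (drop m w)) powr s \<le> (4 * cf_sup w) powr s"
      using cf_sup_append_ge[OF sub(1,2)] sub assms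
      by (intro powr_mono2) (auto intro!: mult_nonneg_nonneg less_imp_le[OF cf_sup_pos])
    thus "cf_sup (take m w) powr s * cf_sup (drop m w) powr s \<le> 4 powr s * cf_sup w powr s"
      using sub by (simp add: powr_mult less_imp_le[OF cf_sup_pos])
  qed
  finally show ?thesis by (simp add: word_sum_def sum_distrib_left)
qed

text \<open>
  A bound of any size improves to a universal one: a sum exceeding the distortion constant would
  grow geometrically along multiples of its length. This is what makes the passage from finite to
  infinite alphabets possible.
\<close>
lemma bounded_word_sum_le:
  assumes F: "finite F" "F \<subseteq> E_star" "0 \<le> s" and bd: "\<And>n. word_sum F n s \<le> C"
  shows "word_sum F n s \<le> 4 powr s"
proof (rule ccontr)
  define a where "a = word_sum F n s / 4 powr s"
  assume "\<not> word_sum F n s \<le> 4 powr s"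
  hence a: "1 < a" by (simp add: a_def)
  have "a ^ k \<le> word_sum F (k * n) s" for k
  proof (induction k)
    case 0
    show ?case by (simp add: word_sum_def words_0 cf_sup_Nil)
  next
    case (Suc k)
    have "a ^ Suc k \<le> a * word_sum F (k * n) s" using Suc a by simp
    also have "\<dots> = word_sum F n s * word_sum F (k * n) s / 4 powr s" by (simp add: a_def)
    also have "\<dots> \<le> 4 powr s * word_sum F (n + k * n) s / 4 powr s"
      by (intro divide_right_mono word_sum_supermultiplicative F) auto
    finally show ?case by simp
  qed
  moreover obtain k where "C < a ^ k" using real_arch_pow[OF a] by blast
  ultimately show False using bd[of "k * n"] by (meson not_le order_trans)
qed

lemma word_sum_decay:
  assumes F: "F \<subseteq> E_star" and "s \<le> t"
  shows "word_sum F n t \<le> ((1/2) ^ (n div 2)) powr (t - s) * word_sum F n s"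
  unfolding word_sum_def sum_distrib_left
proof (rule sum_mono)
  fix w assume w: "w \<in> words F n"
  hence w': "set w \<subseteq> E_star" "length w = n" using F by (auto simp: words_def)
  have "cf_sup w powr t = cf_sup w powr (t - s) * cf_sup w powr s"
    by (simp add: powr_add[symmetric])
  also have "\<dots> \<le> ((1/2) ^ (n div 2)) powr (t - s) * cf_sup w powr s"
    using cf_sup_decay[OF w'(1)] cf_sup_pos[OF w'(1)] assms w'(2)
    by (intro mult_right_mono powr_mono2) auto
  finally show "cf_sup w powr t \<le> ((1/2) ^ (n div 2)) powr (t - s) * cf_sup w powr s" .
qed

section \<open>Null limit sets have bounded word sums\<close>

text \<open>
  After rescaling the points lie in one fixed ball, and a set of a finite cover of that ball by
  balls of radius \<open>a/2\<close> contains at most one of them.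
\<close>
lemma packing_bound:
  assumes "0 < a"
  shows "\<exists>M. \<forall>I (c :: 'i \<Rightarrow> complex) x r. 0 < r \<longrightarrow> (\<forall>i\<in>I. cmod (c i - x) \<le> b * r) \<longrightarrow>
     (\<forall>i\<in>I. \<forall>j\<in>I. i \<noteq> j \<longrightarrow> a * r \<le> cmod (c i - c j)) \<longrightarrow> finite I \<and> card I \<le> M"
proof -
  have "\<exists>k. finite k \<and> k \<subseteq> cball (0::complex) b \<and> cball 0 b \<subseteq> (\<Union>y\<in>k. ball y (a/2))"
    using compact_imp_seq_compact[OF compact_cball] assms
    by (intro seq_compact_imp_totally_bounded[rule_format]) auto
  then obtain k where k: "finite k" "cball (0::complex) b \<subseteq> (\<Union>y\<in>k. ball y (a/2))" by blast
  show ?thesis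
  proof (intro exI[of _ "card k"] allI impI)
    fix I and c :: "'i \<Rightarrow> complex" and x r
    assume r: "0 < r" and near: "\<forall>i\<in>I. cmod (c i - x) \<le> b * r"
      and sep: "\<forall>i\<in>I. \<forall>j\<in>I. i \<noteq> j \<longrightarrow> a * r \<le> cmod (c i - c j)"
    have "\<forall>i\<in>I. \<exists>y\<in>k. dist y ((c i - x) / of_real r) < a/2"
    proof
      fix i assume "i \<in> I"
      hence "(c i - x) / of_real r \<in> cball 0 b" using near r by (simp add: norm_divide field_simps)
      hence "(c i - x) / of_real r \<in> (\<Union>y\<in>k. ball y (a/2))" using k(2) by blast
      thus "\<exists>y\<in>k. dist y ((c i - x) / of_real r) < a/2" by simp
    qed
    then obtain f where f: "\<And>i. i \<in> I \<Longrightarrow> f i \<in> k \<and> dist (f i) ((c i - x) / of_real r) < a/2"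
      by metis
    have "inj_on f I"
    proof (rule inj_onI, rule ccontr)
      fix i j assume ij: "i \<in> I" "j \<in> I" "f i = f j" "i \<noteq> j"
      have "dist ((c i - x) / of_real r) ((c j - x) / of_real r) < a"
        using f[OF ij(1)] f[OF ij(2)] ij(3)
        by (metis dist_commute dist_triangle_half_r)
      moreover have "(c i - x) / of_real r - (c j - x) / of_real r = (c i - c j) / of_real r"
        by (simp add: diff_divide_distrib)
      ultimately have "cmod (c i - c j) < a * r"
        using r by (simp add: dist_norm norm_divide field_simps)
      thus False using sep ij(1,2,4) by fastforce
    qed
    thus "finite I \<and> card I \<le> card k"
      using f k(1) by (auto intro: inj_on_finite card_inj_on_le)
  qed
qed

text \<open>
  The words whose cylinder meets \<open>ball x r\<close> and is the first along its branch to be no larger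
  than the ball.
\<close>
definition cut_words :: "complex set \<Rightarrow> complex \<Rightarrow> real \<Rightarrow> complex list set" where
  "cut_words F x r = {w. set w \<subseteq> F \<and> w \<noteq> [] \<and> cf_sup w \<le> r \<and> r < cf_sup (butlast w) \<and>
     word_map cf_map w ` disk \<inter> ball x r \<noteq> {}}"

lemma cut_words_not_prefix:
  assumes "F \<subseteq> E_star" "w \<in> cut_words F x r" "v \<in> cut_words F x r" "w \<noteq> v"
  shows "\<not> prefix w v"
proof
  assume "prefix w v"
  then obtain zs where zs: "v = w @ zs" "zs \<noteq> []" using assms(4) by (auto elim: prefixE)
  have sub: "set w \<subseteq> E_star" "set (butlast zs) \<subseteq> E_star"
    using assms zs by (auto simp: cut_words_def dest: in_set_butlastD)
  have "cf_sup (butlast v) \<le> cf_sup w * cf_sup (butlast zs)"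
    using cf_sup_append_le[OF sub] zs by (simp add: butlast_append)
  also have "\<dots> \<le> cf_sup w * 1"
    using cf_sup_le_1[OF sub(2)] cf_sup_pos[OF sub(1)] by (intro mult_left_mono) auto
  finally show False using assms(2,3) by (simp add: cut_words_def)
qed

text \<open>
  Over a finite alphabet one more symbol costs a bounded factor, so the cylinders of cut words are
  comparable in size to the ball, and their centres are separated on that scale.
\<close>
lemma card_cut_words:
  assumes "finite F" "F \<subseteq> E_star"
  obtains M where "\<And>x r. 0 < r \<Longrightarrow> finite (cut_words F x r) \<and> card (cut_words F x r) \<le> M"
proof -
  define \<kappa> where "\<kappa> = Min (insert 1 ((\<lambda>e. cf_sup [e]) ` F))"
  have \<kappa>: "0 < \<kappa>" "\<And>e. e \<in> F \<Longrightarrow> \<kappa> \<le> cf_sup [e]"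
    using assms by (auto simp: \<kappa>_def Min_gr_iff intro!: cf_sup_pos)
  have pos: "0 < \<kappa>/32" using \<kappa>(1) by simp
  obtain M where M: "\<forall>I (c :: complex list \<Rightarrow> complex) x r. 0 < r \<longrightarrow>
     (\<forall>i\<in>I. cmod (c i - x) \<le> 2 * r) \<longrightarrow>
     (\<forall>i\<in>I. \<forall>j\<in>I. i \<noteq> j \<longrightarrow> \<kappa>/32 * r \<le> cmod (c i - c j)) \<longrightarrow> finite I \<and> card I \<le> M"
    using packing_bound[OF pos, where b = 2] by blast
  show ?thesis
  proof (rule that[of M], rule M[rule_format, where c = "\<lambda>w. word_map cf_map w (1/2)"])
    fix x and r :: real
    assume r: "0 < r"
    show "0 < r" by (rule r)
    have big: "\<kappa> * r / 16 \<le> cf_jac w (1/2)" if w: "w \<in> cut_words F x r" for w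
    proof -
      have "w \<noteq> []" "set w \<subseteq> F" using w by (auto simp: cut_words_def)
      hence "last w \<in> F" using last_in_set by blast
      hence sub: "set w \<subseteq> E_star" "set (butlast w) \<subseteq> E_star" "set [last w] \<subseteq> E_star" "last w \<in> F" "w \<noteq> []"
        using w assms by (auto simp: cut_words_def dest: in_set_butlastD)
      have "r * \<kappa> \<le> cf_sup (butlast w) * cf_sup [last w]"
        using w r \<kappa>(1) \<kappa>(2)[OF sub(4)] cf_sup_pos[OF sub(2)]
        by (intro mult_mono) (auto simp: cut_words_def)
      also have "\<dots> \<le> 4 * cf_sup w"
        using cf_sup_append_ge[OF sub(2,3)] sub(5) by simp
      also have "cf_sup w \<le> 4 * cf_jac w (1/2)" by (rule cf_sup_le_4_jac[OF sub(1) half_in_disk])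
      finally show ?thesis by (simp add: mult.commute)
    qed
    show "cmod (word_map cf_map w (1/2) - x) \<le> 2 * r" if w: "w \<in> cut_words F x r" for w
    proof -
      have sub: "set w \<subseteq> E_star" "cf_sup w \<le> r" using w assms by (auto simp: cut_words_def)
      obtain y where y: "y \<in> disk" "dist x (word_map cf_map w y) < r"
        using w by (auto simp: cut_words_def)
      have "cmod (word_map cf_map w (1/2) - word_map cf_map w y) \<le> cf_sup w * cmod (1/2 - y)"
        by (rule cf_word_lipschitz[OF sub(1) half_in_disk y(1)])
      also have "\<dots> \<le> r * 1"
        using sub dist_disk_le_1[OF half_in_disk y(1)] r by (intro mult_mono) auto
      finally show ?thesis
        using y(2) dist_triangle[of "word_map cf_map w (1/2)" x "word_map cf_map w y"]
        by (simp add: dist_norm norm_minus_commute)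
    qed
    show "\<kappa>/32 * r \<le> cmod (word_map cf_map w (1/2) - word_map cf_map v (1/2))"
      if wv: "w \<in> cut_words F x r" "v \<in> cut_words F x r" "w \<noteq> v" for w v
    proof -
      have sub: "set w \<subseteq> E_star" "set v \<subseteq> E_star" using wv assms by (auto simp: cut_words_def)
      have "w \<parallel> v" using cut_words_not_prefix[OF assms(2)] wv by (metis parallelI)
      from centres_separated[OF sub this]
      have "(\<kappa> * r / 16) * (\<kappa> * r / 16) \<le> 4 * (cmod (word_map cf_map w (1/2) - word_map cf_map v (1/2)))\<^sup>2"
        using big[OF wv(1)] big[OF wv(2)] \<kappa>(1) r less_imp_le[OF cf_jac_pos[OF sub(1) half_in_disk]]
        by (intro order_trans[OF mult_mono[of "\<kappa> * r / 16" _ "\<kappa> * r / 16"]]) auto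
      hence "(\<kappa>/32 * r)\<^sup>2 \<le> (cmod (word_map cf_map w (1/2) - word_map cf_map v (1/2)))\<^sup>2"
        by (simp add: power2_eq_square)
      thus ?thesis by (rule power2_le_imp_le) simp
    qed
  qed
qed

text \<open>
  Brouwer's fan theorem, the compactness of the sequence space: otherwise some symbol continues
  every word that is not yet uniformly barred, which produces a sequence without a bar.
\<close>
lemma fan:
  assumes "finite F" and bar: "\<And>\<omega>. \<omega> \<in> seqs F \<Longrightarrow> \<exists>n. P (map \<omega> [0..<n])"
  obtains L where "\<And>\<omega>. \<omega> \<in> seqs F \<Longrightarrow> \<exists>n\<le>L. P (map \<omega> [0..<n])"
proof (rule ccontr)
  define avoids where "avoids L \<omega> \<longleftrightarrow> (\<forall>n\<le>L. \<not> P (map \<omega> [0..<n]))" for L \<omega>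
  define bad where "bad w \<longleftrightarrow> (\<forall>L. \<exists>\<omega>\<in>seqs F. map \<omega> [0..<length w] = w \<and> avoids L \<omega>)" for w
  have avoids_mono: "avoids L \<omega>" if "avoids M \<omega>" "L \<le> M" for L M \<omega>
    using that by (auto simp: avoids_def)
  assume no_bound: "\<not> thesis"
  have "\<exists>\<omega>\<in>seqs F. avoids L \<omega>" for L
  proof (rule ccontr)
    assume "\<not> (\<exists>\<omega>\<in>seqs F. avoids L \<omega>)"
    hence "\<And>\<omega>. \<omega> \<in> seqs F \<Longrightarrow> \<exists>n\<le>L. P (map \<omega> [0..<n])" unfolding avoids_def by blast
    from that[OF this] no_bound show False by blast
  qed
  hence bad0: "bad []" by (simp add: bad_def)
  have step: "\<exists>e\<in>F. bad (w @ [e])" if w: "bad w" for w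
  proof (rule ccontr)
    assume "\<not> (\<exists>e\<in>F. bad (w @ [e]))"
    hence "\<forall>e\<in>F. \<exists>L. \<forall>\<omega>\<in>seqs F. map \<omega> [0..<length (w @ [e])] = w @ [e] \<longrightarrow> \<not> avoids L \<omega>"
      unfolding bad_def by metis
    then obtain l where l: "\<forall>e\<in>F. \<forall>\<omega>\<in>seqs F. map \<omega> [0..<length (w @ [e])] = w @ [e] \<longrightarrow> \<not> avoids (l e) \<omega>"
      by metis
    obtain \<omega> where \<omega>: "\<omega> \<in> seqs F" "map \<omega> [0..<length w] = w" "avoids (Max (l ` F)) \<omega>"
      using w unfolding bad_def by metis
    define e where "e = \<omega> (length w)"
    have e: "e \<in> F" using \<omega>(1) by (simp add: seqs_def e_def)
    have "map \<omega> [0..<length (w @ [e])] = w @ [e]" using \<omega>(2) by (simp add: e_def)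
    hence "\<not> avoids (l e) \<omega>" using l e \<omega>(1) by metis
    moreover have "l e \<le> Max (l ` F)" using assms(1) e by simp
    ultimately show False using avoids_mono[OF \<omega>(3)] by metis
  qed
  define next_word where "next_word w = w @ [SOME e. e \<in> F \<and> bad (w @ [e])]" for w
  define W where "W n = (next_word ^^ n) []" for n
  have next_word: "bad (next_word w)" "last (next_word w) \<in> F" if "bad w" for w
    using someI_ex[of "\<lambda>e. e \<in> F \<and> bad (w @ [e])"] step[OF that] by (auto simp: next_word_def)
  have badW: "bad (W n)" for n
    by (induction n) (auto simp: W_def bad0 next_word)
  define \<omega> where "\<omega> n = last (W (Suc n))" for n
  have W: "map \<omega> [0..<n] = W n" for n
    by (induction n) (auto simp: W_def \<omega>_def next_word_def)
  have "\<omega> \<in> seqs F"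
    using next_word(2)[OF badW] by (simp add: seqs_def \<omega>_def W_def)
  then obtain n where n: "P (map \<omega> [0..<n])" using bar by blast
  have "length (W n) = n" using W[of n] by (metis length_map length_upt diff_zero)
  moreover obtain \<omega>' where "map \<omega>' [0..<length (W n)] = W n" "avoids n \<omega>'"
    using badW[of n] unfolding bad_def by metis
  ultimately show False using n W[of n] by (auto simp: avoids_def)
qed

text \<open>
  The cut words of the balls of a cover are a bar, of total weight at most 1 if the cover is fine
  enough. Every word longer than the height of the bar splits at it, so the sum at length \<open>n\<close> is
  at most a combination, with total coefficient at most 1, of sums at smaller lengths; in the end
  only the sums up to the height of the bar matter.
\<close>
lemma word_sum_bounded_of_null:
  assumes F: "finite F" "F \<subseteq> E_star" and s: "0 < s"
    and null: "hausdorff_measure s (limit_set cf_map F) = 0"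
  obtains C where "\<And>n. word_sum F n s \<le> C"
proof -
  obtain M where M: "\<And>x r. 0 < r \<Longrightarrow> finite (cut_words F x r) \<and> card (cut_words F x r) \<le> M"
    using card_cut_words[OF F] by blast
  \<comment> \<open>small enough that every radius is below 1, which keeps the empty word out of the bar, and
    that at most \<open>M\<close> cut words per ball have total weight at most 1\<close>
  define \<eta> where "\<eta> = 1 / (real M + 2)"
  have \<eta>: "0 < \<eta>" "\<eta> < 1" "real M * \<eta> \<le> 1" by (auto simp: \<eta>_def field_simps)
  obtain x :: "nat \<Rightarrow> complex" and r where cov: "limit_set cf_map F \<subseteq> (\<Union>i. ball (x i) (r i))"
    and r: "\<And>i. 0 < r i" and sum_r: "\<And>X. finite X \<Longrightarrow> (\<Sum>i\<in>X. r i powr s) \<le> \<eta>"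
    using hausdorff_measure_zero_balls[OF null s \<eta>(1)] by blast
  have r1: "r i < 1" for i
  proof (rule ccontr)
    assume "\<not> r i < 1"
    hence "1 \<le> r i powr s" using s by (intro ge_one_powr_ge_zero) auto
    thus False using sum_r[of "{i}"] \<eta> by simp
  qed
  define P where "P w \<longleftrightarrow> (\<exists>i. w \<in> cut_words F (x i) (r i))" for w
  have "\<exists>n. P (map \<omega> [0..<n])" if \<omega>: "\<omega> \<in> seqs F" for \<omega>
  proof -
    have \<omega>': "\<omega> \<in> seqs E_star" using \<omega> F(2) by (auto simp: seqs_def)
    obtain i where i: "coding cf_map \<omega> \<in> ball (x i) (r i)"
      using cov \<omega> by (auto simp: limit_set_def)
    define n where "n = (LEAST n. cf_sup (map \<omega> [0..<n]) \<le> r i)"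
    obtain k where "(1/2) ^ k < r i" using real_arch_pow_inv[OF r[of i], of "1/2"] by auto
    moreover have "cf_sup (map \<omega> [0..<2*k]) \<le> (1/2) ^ k"
      using cf_sup_decay[OF set_prefix_seqs[OF \<omega>'], of "2*k"] by simp
    ultimately have ex: "cf_sup (map \<omega> [0..<2*k]) \<le> r i" by simp
    have n: "cf_sup (map \<omega> [0..<n]) \<le> r i" unfolding n_def by (rule LeastI[of "\<lambda>n. cf_sup (map \<omega> [0..<n]) \<le> r i", OF ex])
    have n0: "n \<noteq> 0"
    proof
      assume "n = 0"
      hence "map \<omega> [0..<n] = []" by simp
      hence "1 \<le> r i" using n cf_sup_Nil by simp
      thus False using r1[of i] by simp
    qed
    then obtain m where m: "n = Suc m" by (cases n) auto
    have "\<not> cf_sup (map \<omega> [0..<m]) \<le> r i"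
      using not_less_Least[of m "\<lambda>n. cf_sup (map \<omega> [0..<n]) \<le> r i"] m by (simp add: n_def)
    moreover have "butlast (map \<omega> [0..<n]) = map \<omega> [0..<m]" using m by (simp add: butlast_append)
    moreover have "coding cf_map \<omega> \<in> word_map cf_map (map \<omega> [0..<n]) ` disk"
      using coding_in_cylinders[OF contractive_cf_map \<omega>'] m by blast
    ultimately have "map \<omega> [0..<n] \<in> cut_words F (x i) (r i)"
      using n i n0 set_prefix_seqs[OF \<omega>, of n] by (auto simp: cut_words_def)
    thus ?thesis unfolding P_def by blast
  qed
  then obtain L where L: "\<And>\<omega>. \<omega> \<in> seqs F \<Longrightarrow> \<exists>n\<le>L. P (map \<omega> [0..<n])"
    using fan[OF F(1), of P] by blast
  define W where "W = {w. P w \<and> length w \<le> L}"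
  have W_F: "set w \<subseteq> F \<and> w \<noteq> []" if "w \<in> W" for w
    using that by (auto simp: W_def P_def cut_words_def)
  have fW: "finite W"
    using finite_lists_length_le[OF F(1), of L] by (rule rev_finite_subset) (use W_F W_def in auto)
  have weight: "(\<Sum>w\<in>W. cf_sup w powr s) \<le> 1"
  proof -
    obtain idx where idx: "\<And>w. w \<in> W \<Longrightarrow> w \<in> cut_words F (x (idx w)) (r (idx w))"
      unfolding W_def P_def by atomize_elim (rule choice, auto)
    have "(\<Sum>w\<in>W. cf_sup w powr s) = (\<Sum>i\<in>idx ` W. \<Sum>w | w \<in> W \<and> idx w = i. cf_sup w powr s)"
      by (rule sum.image_gen[OF fW])
    also have "\<dots> \<le> (\<Sum>i\<in>idx ` W. real M * r i powr s)"
    proof (rule sum_mono)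
      fix i
      have fc: "finite (cut_words F (x i) (r i))" "card (cut_words F (x i) (r i)) \<le> M"
        using M[OF r] by auto
      have "(\<Sum>w | w \<in> W \<and> idx w = i. cf_sup w powr s) \<le> (\<Sum>w\<in>cut_words F (x i) (r i). cf_sup w powr s)"
        using fc idx by (intro sum_mono2) auto
      also have "\<dots> \<le> real (card (cut_words F (x i) (r i))) * r i powr s"
        using F(2) s by (intro sum_bounded_above powr_mono2)
          (auto simp: cut_words_def intro!: less_imp_le[OF cf_sup_pos])
      also have "\<dots> \<le> real M * r i powr s" using fc by (intro mult_right_mono) auto
      finally show "(\<Sum>w | w \<in> W \<and> idx w = i. cf_sup w powr s) \<le> real M * r i powr s" .
    qed
    also have "\<dots> \<le> real M * \<eta>"
      unfolding sum_distrib_left[symmetric] using sum_r[of "idx ` W"] fW by (intro mult_left_mono) auto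
    finally show ?thesis using \<eta>(3) by linarith
  qed
  define C where "C = (\<Sum>j\<le>L. word_sum F j s)"
  have C0: "0 \<le> C" unfolding C_def by (intro sum_nonneg word_sum_nonneg)
  have "word_sum F n s \<le> C" for n
  proof (induction n rule: less_induct)
    case (less n)
    show ?case
    proof (cases "n \<le> L")
      case True
      thus ?thesis unfolding C_def by (intro member_le_sum) (auto intro: word_sum_nonneg)
    next
      case False
      have "word_sum F n s
              \<le> (\<Sum>(w, v)\<in>Sigma W (\<lambda>w. words F (n - length w)). cf_sup w powr s * cf_sup v powr s)"
        unfolding word_sum_def
      proof (rule sum_le_included[where i = "\<lambda>(w, v). w @ v"])
        show "\<forall>u\<in>words F n. \<exists>y\<in>Sigma W (\<lambda>w. words F (n - length w)). (case y of (w, v) \<Rightarrow> w @ v) = u \<and>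
          cf_sup u powr s \<le> (case y of (w, v) \<Rightarrow> cf_sup w powr s * cf_sup v powr s)"
        proof
          fix u assume u: "u \<in> words F n"
          hence u': "set u \<subseteq> F" "length u = n" by (auto simp: words_def)
          \<comment> \<open>any extension of \<open>u\<close> to a sequence serves; repeating a symbol of \<open>u\<close> stays inside the alphabet\<close>
          define \<omega> where "\<omega> i = (if i < n then u ! i else u ! 0)" for i
          have "u ! i \<in> F" if "i < n" for i using u' that nth_mem[of i u] by blast
          hence "\<omega> \<in> seqs F" using False by (auto simp: seqs_def \<omega>_def)
          then obtain k where k: "k \<le> L" "P (map \<omega> [0..<k])" using L by blast
          have eq: "map \<omega> [0..<k] = take k u"
            using k(1) False u'(2) by (intro nth_equalityI) (auto simp: \<omega>_def)
          have mem: "take k u \<in> W" using k eq u' by (simp add: W_def)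
          have mem': "drop k u \<in> words F (n - length (take k u))"
            using u' k(1) False by (auto simp: words_def dest: in_set_dropD)
          have sub: "set (take k u) \<subseteq> E_star" "set (drop k u) \<subseteq> E_star" "set u \<subseteq> E_star"
            using u' F by (auto dest: in_set_takeD in_set_dropD)
          have "cf_sup u powr s \<le> (cf_sup (take k u) * cf_sup (drop k u)) powr s"
            using cf_sup_append_le[OF sub(1,2)] s cf_sup_pos[OF sub(3)] by (intro powr_mono2) auto
          also have "\<dots> = cf_sup (take k u) powr s * cf_sup (drop k u) powr s"
            using sub by (intro powr_mult less_imp_le[OF cf_sup_pos])
          finally show "\<exists>y\<in>Sigma W (\<lambda>w. words F (n - length w)). (case y of (w, v) \<Rightarrow> w @ v) = u \<and>
              cf_sup u powr s \<le> (case y of (w, v) \<Rightarrow> cf_sup w powr s * cf_sup v powr s)"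
            using mem mem' by (intro bexI[of _ "(take k u, drop k u)"]) auto
        qed
      qed (use F fW finite_words in auto)
      also have "\<dots> = (\<Sum>w\<in>W. cf_sup w powr s * word_sum F (n - length w) s)"
        using fW F by (simp add: sum.Sigma[symmetric] finite_words word_sum_def sum_distrib_left)
      also have "\<dots> \<le> (\<Sum>w\<in>W. cf_sup w powr s * C)"
        using less W_F False by (intro sum_mono mult_left_mono) auto
      also have "\<dots> \<le> 1 * C"
        unfolding sum_distrib_right[symmetric] using weight C0 by (intro mult_right_mono)
      finally show ?thesis by simp
    qed
  qed
  thus ?thesis by (rule that)
qed

section \<open>The pressure hypothesis\<close>

lemma exp_ext_le: "x \<le> ereal y \<Longrightarrow> exp_ext x \<le> ennreal (exp y)"
  by (cases x) (auto simp: exp_ext_def intro: ennreal_leI)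

lemma ln_ext_le:
  assumes "x \<le> ennreal y" "0 < y"
  shows "ln_ext x \<le> ereal (ln y)"
proof (cases "x = 0")
  case False
  have fin: "x < \<infinity>" using assms(1) by (metis ennreal_less_top infinity_ennreal_def le_less_trans)
  have "0 < enn2real x" using False fin by (simp add: enn2real_positive_iff zero_less_iff_neq_zero)
  moreover have "enn2real x \<le> y" using assms by (simp add: enn2real_leI)
  ultimately show ?thesis using False fin by (auto simp: ln_ext_def)
qed (simp add: ln_ext_def)

text \<open>
  A Birkhoff sum of the potential is the logarithm of a derivative at a point of the disk, hence
  at most the logarithm of the supremum.
\<close>
lemma partition_sum_le:
  assumes E: "E \<subseteq> E_star" and s: "0 \<le> s"
    and bd: "\<And>F. finite F \<Longrightarrow> F \<subseteq> E \<Longrightarrow> word_sum F n s \<le> C"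
  shows "partition_sum E (\<lambda>\<omega>. s * cf_potential \<omega>) n \<le> ennreal C"
proof -
  define f where "f = (\<lambda>w. exp_ext (SUP \<omega>\<in>cylinder E w. ereal (\<Sum>i<n. s * cf_potential ((shift ^^ i) \<omega>))))"
  have bound: "f w \<le> ennreal (cf_sup w powr s)" if w: "w \<in> words E n" for w
  proof -
    have len: "length w = n" and sub: "set w \<subseteq> E_star" using w E by (auto simp: words_def)
    have "(SUP \<omega>\<in>cylinder E w. ereal (\<Sum>i<n. s * cf_potential ((shift ^^ i) \<omega>))) \<le> ereal (s * ln (cf_sup w))"
    proof (rule SUP_least)
      fix \<omega> assume \<omega>: "\<omega> \<in> cylinder E w"
      have \<omega>E: "\<omega> \<in> seqs E_star" using \<omega> E by (auto simp: cylinder_def seqs_def)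
      have pre: "map \<omega> [0..<n] = w"
        using \<omega> len by (intro nth_equalityI) (auto simp: cylinder_def)
      define z where "z = coding cf_map ((shift ^^ n) \<omega>)"
      have z: "z \<in> disk"
        unfolding z_def by (intro coding_in_disk[OF contractive_cf_map] shift_funpow_seqs \<omega>E)
      have "(\<Sum>i<n. s * cf_potential ((shift ^^ i) \<omega>)) = s * ln (cf_jac w z)"
        unfolding sum_distrib_left[symmetric] birkhoff_sum_eq_ln_jac[OF \<omega>E] pre z_def ..
      also have "\<dots> \<le> s * ln (cf_sup w)"
        using cf_jac_le_sup[OF sub z] cf_jac_pos[OF sub z] s by (intro mult_left_mono) auto
      finally show "ereal (\<Sum>i<n. s * cf_potential ((shift ^^ i) \<omega>)) \<le> ereal (s * ln (cf_sup w))"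
        by simp
    qed
    hence "f w \<le> ennreal (exp (s * ln (cf_sup w)))" unfolding f_def by (rule exp_ext_le)
    thus ?thesis using cf_sup_pos[OF sub] by (simp add: powr_def)
  qed
  have "partition_sum E (\<lambda>\<omega>. s * cf_potential \<omega>) n = infsum f (words E n)"
    by (simp add: partition_sum_def f_def)
  also have "\<dots> \<le> ennreal C"
  proof (rule infsum_le_finite_sums)
    show "f summable_on words E n" by (intro nonneg_summable_on_complete) simp
    fix X assume X: "finite X" "X \<subseteq> words E n"
    define F where "F = \<Union> (set ` X)"
    have F: "finite F" "F \<subseteq> E" using X by (auto simp: F_def words_def)
    have XF: "X \<subseteq> words F n" using X by (auto simp: F_def words_def)
    have "sum f X \<le> (\<Sum>w\<in>X. ennreal (cf_sup w powr s))" using X bound by (intro sum_mono) auto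
    also have "\<dots> = ennreal (\<Sum>w\<in>X. cf_sup w powr s)" by simp
    also have "\<dots> \<le> ennreal (word_sum F n s)"
      unfolding word_sum_def using XF by (intro ennreal_leI sum_mono2 finite_words F) auto
    also have "\<dots> \<le> ennreal C" using bd[OF F] by (rule ennreal_leI)
    finally show "sum f X \<le> ennreal C" .
  qed
  finally show ?thesis .
qed

lemma pressure_negative_if_exponential_decay:
  assumes pressure: "has_pressure E f p" and "0 < c" "0 < d"
    and bd: "\<And>n. partition_sum E f n \<le> ennreal (c * ((1/2) ^ (n div 2)) powr d)"
  shows "p < 0"
proof -
  have le: "ereal (1 / real n) * ln_ext (partition_sum E f n)
          \<le> ereal ((ln c + d) * (1 / real n) - d * ln 2 / 2)" if n: "1 \<le> n" for n
  proof -
    have "real n / 2 - 1/2 \<le> real (n div 2)" by linarith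
    hence "d * ln 2 * (real n / 2 - 1/2) \<le> d * ln 2 * real (n div 2)"
      using assms by (intro mult_left_mono) auto
    moreover have "d * ln 2 \<le> d * 1" using assms ln_2_less_1 by (intro mult_left_mono) auto
    moreover have "ln (c * ((1/2) ^ (n div 2)) powr d) = ln c - d * ln 2 * real (n div 2)"
      using assms by (simp add: ln_mult ln_powr ln_realpow ln_div)
    moreover have "d * ln 2 * (real n / 2 - 1/2) = d * ln 2 / 2 * real n - d * ln 2 / 2"
      by (simp add: field_simps)
    ultimately have "ln (c * ((1/2) ^ (n div 2)) powr d) \<le> (ln c + d) - d * ln 2 / 2 * real n"
      using \<open>0 < d\<close> by linarith
    hence "1 / real n * ln (c * ((1/2) ^ (n div 2)) powr d)
             \<le> 1 / real n * ((ln c + d) - d * ln 2 / 2 * real n)"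
      by (intro mult_left_mono) auto
    also have "\<dots> = (ln c + d) * (1 / real n) - d * ln 2 / 2"
      using n by (simp add: field_simps)
    finally have *: "ereal (1 / real n) * ereal (ln (c * ((1/2) ^ (n div 2)) powr d))
             \<le> ereal ((ln c + d) * (1 / real n) - d * ln 2 / 2)" by simp
    have "ln_ext (partition_sum E f n) \<le> ereal (ln (c * ((1/2) ^ (n div 2)) powr d))"
      using assms by (intro ln_ext_le bd) auto
    from ereal_mult_left_mono[OF this, of "ereal (1 / real n)"] * show ?thesis
      by (meson order_trans divide_nonneg_nonneg ereal_less_eq(5) of_nat_0_le_iff zero_le_one)
  qed
  have lim: "(\<lambda>n. ereal ((ln c + d) * (1 / real n) - d * ln 2 / 2)) \<longlonglongrightarrow> ereal ((ln c + d) * 0 - d * ln 2 / 2)"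
    by (intro tendsto_intros lim_1_over_n)
  have "p \<le> ereal ((ln c + d) * 0 - d * ln 2 / 2)"
    by (rule LIMSEQ_le[OF pressure[unfolded has_pressure_def] lim]) (use le in blast)
  also have "\<dots> < 0" using assms by simp
  finally show ?thesis .
qed

section \<open>The perturbed system\<close>

lemma word_map_cong: "(\<And>e. e \<in> set w \<Longrightarrow> S e = T e) \<Longrightarrow> word_map S w = word_map T w"
  by (induction w) auto

lemma limit_set_subset_perturbed:
  assumes "E \<subseteq> Ehat"
  shows "limit_set cf_map E \<subseteq> limit_set (cf_perturbed E \<epsilon>) Ehat"
proof -
  have "coding cf_map \<omega> = coding (cf_perturbed E \<epsilon>) \<omega>" if "\<omega> \<in> seqs E" for \<omega>
  proof -
    have "word_map cf_map (map \<omega> [0..<Suc k]) = word_map (cf_perturbed E \<epsilon>) (map \<omega> [0..<Suc k])" for k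
      using set_prefix_seqs[OF that, of "Suc k"] by (intro word_map_cong) (auto simp: cf_perturbed_def fun_eq_iff)
    thus ?thesis by (simp only: coding_def)
  qed
  moreover have "seqs E \<subseteq> seqs Ehat" using assms by (auto simp: seqs_def)
  ultimately show ?thesis by (auto simp: limit_set_def)
qed

text \<open>A perturbed map is an unperturbed one after a homothety towards the centre of the disk.\<close>
definition shrink :: "complex set \<Rightarrow> real \<Rightarrow> complex \<Rightarrow> complex \<Rightarrow> complex" where
  "shrink E \<epsilon> e z = (if e \<in> E then z else 1/2 + complex_of_real \<epsilon> * (z - 1/2))"

lemma cf_perturbed_eq: "cf_perturbed E \<epsilon> e z = cf_map e (shrink E \<epsilon> e z)"
  by (simp add: cf_perturbed_def shrink_def cf_map_def add.assoc)

lemma shrink_in_disk: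
  assumes "0 < \<epsilon>" "\<epsilon> \<le> 1" "z \<in> disk"
  shows "shrink E \<epsilon> e z \<in> disk"
proof -
  have "\<epsilon> * cmod (z - 1/2) \<le> 1 * (1/2)"
    using assms by (intro mult_mono) (auto simp: disk_def)
  thus ?thesis using assms by (auto simp: shrink_def disk_def norm_mult)
qed

lemma shrink_diff:
  assumes "0 < \<epsilon>"
  shows "cmod (shrink E \<epsilon> e x - shrink E \<epsilon> e y) = (if e \<in> E then 1 else \<epsilon>) * cmod (x - y)"
proof -
  have "complex_of_real \<epsilon> * (x - 1/2) - complex_of_real \<epsilon> * (y - 1/2) = complex_of_real \<epsilon> * (x - y)"
    by (simp add: algebra_simps)
  hence "cmod (complex_of_real \<epsilon> * (x - 1/2) - complex_of_real \<epsilon> * (y - 1/2)) = \<epsilon> * cmod (x - y)"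
    using assms by (simp add: norm_mult)
  thus ?thesis by (simp add: shrink_def)
qed

lemma cf_perturbed_in_disk:
  "e \<in> E_star \<Longrightarrow> 0 < \<epsilon> \<Longrightarrow> \<epsilon> \<le> 1 \<Longrightarrow> z \<in> disk \<Longrightarrow> cf_perturbed E \<epsilon> e z \<in> disk"
  unfolding cf_perturbed_eq by (intro cf_map_in_disk shrink_in_disk)

lemma cf_perturbed_word_in_disk:
  "set w \<subseteq> E_star \<Longrightarrow> 0 < \<epsilon> \<Longrightarrow> \<epsilon> \<le> 1 \<Longrightarrow> z \<in> disk \<Longrightarrow> word_map (cf_perturbed E \<epsilon>) w z \<in> disk"
  by (rule word_map_in_disk) (auto intro!: cf_perturbed_in_disk)

lemma cf_perturbed_lipschitz:
  assumes e: "e \<in> E_star" and \<epsilon>: "0 < \<epsilon>" "\<epsilon> \<le> 1" and x: "x \<in> disk" and y: "y \<in> disk"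
  shows "cmod (cf_perturbed E \<epsilon> e x - cf_perturbed E \<epsilon> e y)
           \<le> (if e \<in> E then 1 else \<epsilon>) * cf_sup [e] * cmod (x - y)"
proof -
  have "cmod (cf_map e (shrink E \<epsilon> e x) - cf_map e (shrink E \<epsilon> e y))
          \<le> cf_sup [e] * cmod (shrink E \<epsilon> e x - shrink E \<epsilon> e y)"
    using cf_word_lipschitz[of "[e]", OF _ shrink_in_disk[OF \<epsilon> x] shrink_in_disk[OF \<epsilon> y]] e by simp
  thus ?thesis unfolding cf_perturbed_eq shrink_diff[OF \<epsilon>(1)] by (simp add: mult_ac)
qed

lemma contractive_cf_perturbed:
  assumes \<epsilon>: "0 < \<epsilon>" "\<epsilon> \<le> 1/2"
  shows "contractive (cf_perturbed E \<epsilon>) E_star"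
proof -
  let ?S = "cf_perturbed E \<epsilon>"
  have \<epsilon>1: "\<epsilon> \<le> 1" using \<epsilon> by simp
  have one: "cmod (?S e x - ?S e y) \<le> (if e \<in> E then 1 else \<epsilon>) * cmod (x - y)"
    if "e \<in> E_star" "x \<in> disk" "y \<in> disk" for e x y
  proof -
    have "(if e \<in> E then 1 else \<epsilon>) * cf_sup [e] \<le> (if e \<in> E then 1 else \<epsilon>) * 1"
      using cf_sup_le_1[of "[e]"] that \<epsilon> by (intro mult_left_mono) auto
    hence "(if e \<in> E then 1 else \<epsilon>) * cf_sup [e] * cmod (x - y) \<le> (if e \<in> E then 1 else \<epsilon>) * cmod (x - y)"
      by (intro mult_right_mono) auto
    thus ?thesis using cf_perturbed_lipschitz[OF that(1) \<epsilon>(1) \<epsilon>1 that(2,3), of E] by linarith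
  qed
  have one': "cmod (?S e x - ?S e y) \<le> cmod (x - y)"
    if "e \<in> E_star" "x \<in> disk" "y \<in> disk" for e x y
  proof -
    have "(if e \<in> E then 1 else \<epsilon>) * cmod (x - y) \<le> 1 * cmod (x - y)"
      using \<epsilon> by (intro mult_right_mono) auto
    thus ?thesis using one[OF that] by linarith
  qed
  have two: "cmod (?S e (?S f x) - ?S e (?S f y)) \<le> 1/2 * cmod (x - y)"
    if ef: "e \<in> E_star" "f \<in> E_star" and xy: "x \<in> disk" "y \<in> disk" for e f x y
  proof (cases "e \<in> E")
    case False
    have "cmod (?S e (?S f x) - ?S e (?S f y)) \<le> \<epsilon> * cmod (?S f x - ?S f y)"
      using one[OF ef(1), of "?S f x" "?S f y"] False ef xy \<epsilon> \<epsilon>1 by (auto simp: cf_perturbed_in_disk)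
    also have "\<dots> \<le> 1/2 * cmod (x - y)"
      using \<epsilon> one'[OF ef(2) xy] by (intro mult_mono) auto
    finally show ?thesis .
  next
    case True
    define p q where "p = shrink E \<epsilon> f x" and "q = shrink E \<epsilon> f y"
    have pq: "p \<in> disk" "q \<in> disk" using xy \<epsilon> \<epsilon>1 by (auto simp: p_def q_def intro!: shrink_in_disk)
    have le: "cmod (p - q) \<le> cmod (x - y)"
    proof -
      have "(if f \<in> E then 1 else \<epsilon>) * cmod (x - y) \<le> 1 * cmod (x - y)"
        using \<epsilon> by (intro mult_right_mono) auto
      thus ?thesis unfolding p_def q_def shrink_diff[OF \<epsilon>(1)] by simp
    qed
    have "cf_sup [e, f] \<le> 1/2" using cf_sup_decay[of "[e, f]"] ef by simp
    hence "cf_sup [e, f] * cmod (p - q) \<le> 1/2 * cmod (x - y)"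
      using le by (intro mult_mono) auto
    moreover have "cmod (cf_map e (cf_map f p) - cf_map e (cf_map f q)) \<le> cf_sup [e, f] * cmod (p - q)"
      using cf_word_lipschitz[of "[e, f]" p q] ef pq by simp
    moreover have "?S e (?S f x) = cf_map e (cf_map f p)" "?S e (?S f y) = cf_map e (cf_map f q)"
      using True by (simp_all add: cf_perturbed_eq p_def q_def) (simp_all add: shrink_def)
    ultimately show ?thesis by simp
  qed
  have "cmod (word_map ?S w x - word_map ?S w y) \<le> (1/2) ^ (length w div 2) * cmod (x - y)"
    if "set w \<subseteq> E_star" "x \<in> disk" "y \<in> disk" for w x y
    using that
  proof (induction w rule: induct_list012)
    case (2 e)
    thus ?case using one' by simp
  next
    case (3 e f w)
    hence mem: "e \<in> E_star" "f \<in> E_star" "set w \<subseteq> E_star" by auto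
    have "cmod (word_map ?S (e # f # w) x - word_map ?S (e # f # w) y)
            \<le> 1/2 * cmod (word_map ?S w x - word_map ?S w y)"
      unfolding word_map.simps comp_def
      by (intro two mem cf_perturbed_word_in_disk \<epsilon>(1) \<epsilon>1 3)
    also have "\<dots> \<le> 1/2 * ((1/2) ^ (length w div 2) * cmod (x - y))"
      using 3 by (intro mult_left_mono) auto
    finally show ?case by simp
  qed simp
  moreover have "?S e ` disk \<subseteq> disk" if "e \<in> E_star" for e
    using that \<epsilon> \<epsilon>1 by (auto intro: cf_perturbed_in_disk)
  ultimately show ?thesis unfolding contractive_def by blast
qed

text \<open>
  A word that uses at least one perturbed map contracts by an additional factor \<open>\<epsilon>\<close>. The product
  of the one-step bounds is a crude estimate for such words, but \<open>\<epsilon>\<close> compensates for it.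
\<close>
definition perturbed_rate :: "complex set \<Rightarrow> real \<Rightarrow> complex list \<Rightarrow> real" where
  "perturbed_rate E \<epsilon> w =
     (if set w \<subseteq> E then cf_sup w else \<epsilon> * prod_list (map (\<lambda>e. cf_sup [e]) w))"

lemma prod_list_cf_sup_pos: "set w \<subseteq> E_star \<Longrightarrow> 0 < prod_list (map (\<lambda>e. cf_sup [e]) w)"
  by (induction w) (auto intro!: mult_pos_pos cf_sup_pos)

lemma perturbed_rate_nonneg: "set w \<subseteq> E_star \<Longrightarrow> 0 < \<epsilon> \<Longrightarrow> 0 \<le> perturbed_rate E \<epsilon> w"
  using cf_sup_pos[of w] prod_list_cf_sup_pos[of w] by (simp add: perturbed_rate_def)

lemma perturbed_word_lipschitz:
  assumes w: "set w \<subseteq> E_star" and \<epsilon>: "0 < \<epsilon>" "\<epsilon> \<le> 1" and x: "x \<in> disk" and y: "y \<in> disk"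
  shows "cmod (word_map (cf_perturbed E \<epsilon>) w x - word_map (cf_perturbed E \<epsilon>) w y)
           \<le> perturbed_rate E \<epsilon> w * cmod (x - y)"
proof (cases "set w \<subseteq> E")
  case True
  have "word_map (cf_perturbed E \<epsilon>) w = word_map cf_map w"
    using True by (intro word_map_cong) (auto simp: cf_perturbed_def fun_eq_iff)
  thus ?thesis using cf_word_lipschitz[OF w x y] True by (simp add: perturbed_rate_def)
next
  case False
  have "cmod (word_map (cf_perturbed E \<epsilon>) w x - word_map (cf_perturbed E \<epsilon>) w y)
          \<le> (if set w \<subseteq> E then 1 else \<epsilon>) * prod_list (map (\<lambda>e. cf_sup [e]) w) * cmod (x - y)"
    using w
  proof (induction w)
    case (Cons e w)
    let ?d = "cmod (word_map (cf_perturbed E \<epsilon>) w x - word_map (cf_perturbed E \<epsilon>) w y)"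
    let ?b = "prod_list (map (\<lambda>e. cf_sup [e]) w)"
    have b: "0 < ?b" "0 < cf_sup [e]" using Cons prod_list_cf_sup_pos[of w] cf_sup_pos[of "[e]"] by auto
    have "cmod (word_map (cf_perturbed E \<epsilon>) (e # w) x - word_map (cf_perturbed E \<epsilon>) (e # w) y)
            \<le> (if e \<in> E then 1 else \<epsilon>) * cf_sup [e] * ?d"
      unfolding word_map.simps comp_def using Cons.prems
      by (intro cf_perturbed_lipschitz cf_perturbed_word_in_disk \<epsilon> x y) auto
    also have "\<dots> \<le> (if e \<in> E then 1 else \<epsilon>) * cf_sup [e] * ((if set w \<subseteq> E then 1 else \<epsilon>) * ?b * cmod (x - y))"
      using Cons \<epsilon> b by (intro mult_left_mono) auto
    also have "\<dots> = (if e \<in> E then 1 else \<epsilon>) * (if set w \<subseteq> E then 1 else \<epsilon>) * (cf_sup [e] * ?b * cmod (x - y))"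
      by (simp only: mult_ac)
    also have "\<dots> \<le> (if set (e # w) \<subseteq> E then 1 else \<epsilon>) * (cf_sup [e] * ?b * cmod (x - y))"
      using \<epsilon> b by (intro mult_right_mono) (auto simp: mult_le_one)
    finally show ?case by (simp add: mult.assoc)
  qed simp
  thus ?thesis using False by (simp add: perturbed_rate_def)
qed

lemma words_1: "words F 1 = (\<lambda>e. [e]) ` F"
  by (auto simp: words_def length_Suc_conv)

lemma sum_prod_words:
  fixes a :: "'a \<Rightarrow> real"
  shows "(\<Sum>w\<in>words F n. prod_list (map a w)) = (\<Sum>e\<in>F. a e) ^ n"
proof (induction n)
  case (Suc n)
  have split: "prod_list (map a w) = prod_list (map a (take 1 w)) * prod_list (map a (drop 1 w))" for w
    by (metis append_take_drop_id map_append prod_list.append)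
  have "(\<Sum>w\<in>words F (1 + n). prod_list (map a w))
          = (\<Sum>w\<in>words F 1. prod_list (map a w)) * (\<Sum>w\<in>words F n. prod_list (map a w))"
    by (subst split, rule sum_words_add)
  also have "(\<Sum>w\<in>words F 1. prod_list (map a w)) = (\<Sum>e\<in>F. a e)"
    unfolding words_1 by (subst sum.reindex) (auto simp: inj_on_def)
  finally show ?case using Suc by simp
qed (simp add: words_0)

lemma prod_list_powr:
  fixes a :: "'a \<Rightarrow> real"
  shows "(\<And>e. e \<in> set w \<Longrightarrow> 0 \<le> a e) \<Longrightarrow> prod_list (map a w) powr t = prod_list (map (\<lambda>e. a e powr t) w)"
proof (induction w)
  case (Cons e w)
  have "0 \<le> prod_list (map a w)" using Cons by (intro prod_list_nonneg) auto
  thus ?case using Cons by (simp add: powr_mult)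
qed simp

lemma perturbed_word_sum_le:
  assumes F: "finite F" "F \<subseteq> E_star" and "0 < t" "0 < \<epsilon>"
  shows "(\<Sum>w\<in>words F n. perturbed_rate E \<epsilon> w powr t)
           \<le> word_sum (F \<inter> E) n t + \<epsilon> powr t * (\<Sum>e\<in>F. cf_sup [e] powr t) ^ n"
proof -
  have "(\<Sum>w\<in>words F n. perturbed_rate E \<epsilon> w powr t)
          \<le> (\<Sum>w\<in>words F n. (if set w \<subseteq> E then cf_sup w powr t else 0)
               + \<epsilon> powr t * prod_list (map (\<lambda>e. cf_sup [e] powr t) w))"
  proof (rule sum_mono)
    fix w assume "w \<in> words F n"
    hence w: "set w \<subseteq> E_star" using F by (auto simp: words_def)
    hence "0 \<le> cf_sup [e]" if "e \<in> set w" for e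
      using that by (intro less_imp_le[OF cf_sup_pos]) auto
    hence eq: "prod_list (map (\<lambda>e. cf_sup [e]) w) powr t = prod_list (map (\<lambda>e. cf_sup [e] powr t) w)"
      by (rule prod_list_powr)
    have "0 \<le> \<epsilon> powr t * prod_list (map (\<lambda>e. cf_sup [e]) w) powr t" by simp
    thus "perturbed_rate E \<epsilon> w powr t \<le> (if set w \<subseteq> E then cf_sup w powr t else 0)
               + \<epsilon> powr t * prod_list (map (\<lambda>e. cf_sup [e] powr t) w)"
      using assms less_imp_le[OF prod_list_cf_sup_pos[OF w]] unfolding eq
      by (auto simp: perturbed_rate_def powr_mult eq)
  qed
  also have "\<dots> = (\<Sum>w\<in>words F n. if set w \<subseteq> E then cf_sup w powr t else 0)
                   + \<epsilon> powr t * (\<Sum>e\<in>F. cf_sup [e] powr t) ^ n"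
    by (simp add: sum.distrib sum_distrib_left[symmetric] sum_prod_words)
  also have "(\<Sum>w\<in>words F n. if set w \<subseteq> E then cf_sup w powr t else 0) = word_sum (F \<inter> E) n t"
    unfolding word_sum_def using finite_words[OF F(1), of n]
    by (intro sum.mono_neutral_cong_right) (auto simp: words_def)
  finally show ?thesis .
qed

section \<open>Null limit sets from a small word sum\<close>

fun block_product :: "('a list \<Rightarrow> real) \<Rightarrow> nat \<Rightarrow> nat \<Rightarrow> 'a list \<Rightarrow> real" where
  "block_product l n 0 w = 1"
| "block_product l n (Suc k) w = l (take n w) * block_product l n k (drop n w)"

text \<open>
  Cutting words into blocks of length \<open>n\<close> multiplies the rates as well as the sums, so the
  cylinders of length \<open>k n\<close> cover the limit set with \<open>t\<close>-th powers of diameters of total at most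
  \<open>q ^ k\<close>.
\<close>
lemma limit_set_null:
  assumes S: "contractive S A" and "countable A" and t: "0 < t"
    and l: "\<And>w. w \<in> words A n \<Longrightarrow> 0 \<le> l w"
    and lip: "\<And>w x y. w \<in> words A n \<Longrightarrow> x \<in> disk \<Longrightarrow> y \<in> disk \<Longrightarrow>
                cmod (word_map S w x - word_map S w y) \<le> l w * cmod (x - y)"
    and q: "0 \<le> q" "q < 1"
    and sum_l: "\<And>F. finite F \<Longrightarrow> F \<subseteq> A \<Longrightarrow> (\<Sum>w\<in>words F n. l w powr t) \<le> q"
  shows "hausdorff_measure t (limit_set S A) = 0"
proof -
  have split: "take n w \<in> words A n" "drop n w \<in> words A (k * n)" if "w \<in> words A (Suc k * n)" for w k
    using that by (auto simp: words_def dest: in_set_takeD in_set_dropD)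
  have nonneg: "0 \<le> block_product l n k w" if "w \<in> words A (k * n)" for k w
    using that
  proof (induction k arbitrary: w)
    case (Suc k)
    thus ?case using split[OF Suc.prems] l by (auto intro!: mult_nonneg_nonneg)
  qed simp
  have in_disk: "word_map S w x \<in> disk" if "set w \<subseteq> A" "x \<in> disk" for w x
    using that contractiveD(1)[OF S] by (intro word_map_in_disk) auto
  have lips: "cmod (word_map S w x - word_map S w y) \<le> block_product l n k w * cmod (x - y)"
    if "w \<in> words A (k * n)" "x \<in> disk" "y \<in> disk" for k w x y
    using that(1)
  proof (induction k arbitrary: w)
    case 0
    thus ?case by (simp add: words_0)
  next
    case (Suc k)
    note sp = split[OF Suc.prems]
    have eq: "word_map S w z = word_map S (take n w) (word_map S (drop n w) z)" for z
      by (metis append_take_drop_id word_map_append)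
    have "cmod (word_map S w x - word_map S w y)
            \<le> l (take n w) * cmod (word_map S (drop n w) x - word_map S (drop n w) y)"
      unfolding eq using sp that by (intro lip in_disk words_set[OF sp(2)])
    also have "\<dots> \<le> l (take n w) * (block_product l n k (drop n w) * cmod (x - y))"
      by (intro mult_left_mono Suc.IH sp l)
    finally show ?case by (simp add: mult.assoc)
  qed
  have sums: "(\<Sum>w\<in>words F (k * n). block_product l n k w powr t) \<le> q ^ k"
    if F: "finite F" "F \<subseteq> A" for F k
  proof (induction k)
    case 0
    show ?case by (simp add: words_0)
  next
    case (Suc k)
    have "(\<Sum>w\<in>words F (n + k * n). block_product l n (Suc k) w powr t)
            = (\<Sum>w\<in>words F (n + k * n). l (take n w) powr t * block_product l n k (drop n w) powr t)"
    proof (rule sum.cong)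
      fix w assume "w \<in> words F (n + k * n)"
      hence "w \<in> words A (Suc k * n)" using words_mono[OF F(2), of "n + k * n"] by auto
      thus "block_product l n (Suc k) w powr t = l (take n w) powr t * block_product l n k (drop n w) powr t"
        using split[of w k] l nonneg by (simp add: powr_mult)
    qed simp
    also have "\<dots> = (\<Sum>w\<in>words F n. l w powr t) * (\<Sum>w\<in>words F (k * n). block_product l n k w powr t)"
      by (rule sum_words_add)
    also have "\<dots> \<le> q * q ^ k"
      using sum_l[OF F] Suc q by (intro mult_mono) (auto intro: sum_nonneg)
    finally show ?case by simp
  qed
  have "\<exists>k. q ^ k \<le> \<eta>" if "0 < \<eta>" for \<eta> :: real
    using real_arch_pow_inv[OF that q(2)] by (auto intro: less_imp_le)
  then obtain K where K: "\<And>\<eta>. 0 < \<eta> \<Longrightarrow> q ^ K \<eta> \<le> \<eta>" by metis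
  show ?thesis
  proof (rule hausdorff_measure_zeroI[OF t])
    fix \<eta> :: real assume \<eta>: "0 < \<eta>"
    show "countable (words A (K \<eta> * n))"
      by (rule countable_subset[OF _ countable_lists[OF assms(2)]]) (auto simp: words_def)
    show "limit_set S A \<subseteq> (\<Union>w\<in>words A (K \<eta> * n). word_map S w ` disk)"
    proof
      fix z assume "z \<in> limit_set S A"
      then obtain \<omega> where \<omega>: "\<omega> \<in> seqs A" "z = coding S \<omega>" by (auto simp: limit_set_def)
      have "z = word_map S (map \<omega> [0..<K \<eta> * n]) (coding S ((shift ^^ (K \<eta> * n)) \<omega>))"
        unfolding \<omega>(2) by (rule coding_eq_word_map[OF S \<omega>(1)])
      moreover have "coding S ((shift ^^ (K \<eta> * n)) \<omega>) \<in> disk"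
        by (intro coding_in_disk[OF S] shift_funpow_seqs \<omega>)
      moreover have "map \<omega> [0..<K \<eta> * n] \<in> words A (K \<eta> * n)"
        using set_prefix_seqs[OF \<omega>(1)] by (simp add: words_def)
      ultimately show "z \<in> (\<Union>w\<in>words A (K \<eta> * n). word_map S w ` disk)" by blast
    qed
    show "bounded (word_map S w ` disk) \<and> diameter (word_map S w ` disk) \<le> block_product l n (K \<eta>) w"
      if w: "w \<in> words A (K \<eta> * n)" for w
    proof
      have "word_map S w ` disk \<subseteq> disk" using in_disk words_set[OF w] by auto
      thus "bounded (word_map S w ` disk)" using compact_imp_bounded[OF compact_disk] bounded_subset by blast
      show "diameter (word_map S w ` disk) \<le> block_product l n (K \<eta>) w"
      proof (rule diameter_le)
        fix a b assume "a \<in> word_map S w ` disk" "b \<in> word_map S w ` disk"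
        then obtain x y where xy: "x \<in> disk" "y \<in> disk" "a = word_map S w x" "b = word_map S w y" by auto
        have "cmod (a - b) \<le> block_product l n (K \<eta>) w * cmod (x - y)"
          unfolding xy by (rule lips[OF w xy(1,2)])
        also have "\<dots> \<le> block_product l n (K \<eta>) w * 1"
          by (intro mult_left_mono dist_disk_le_1 xy nonneg[OF w])
        finally show "cmod (a - b) \<le> block_product l n (K \<eta>) w" by simp
      qed (use nonneg[OF w] in auto)
    qed
    fix X assume X: "finite X" "X \<subseteq> words A (K \<eta> * n)"
    define F where "F = \<Union> (set ` X)"
    have F: "finite F" "F \<subseteq> A" using X by (auto simp: F_def words_def)
    have XF: "X \<subseteq> words F (K \<eta> * n)" using X by (auto simp: F_def words_def)
    have "(\<Sum>w\<in>X. block_product l n (K \<eta>) w powr t)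
            \<le> (\<Sum>w\<in>words F (K \<eta> * n). block_product l n (K \<eta>) w powr t)"
      using XF by (intro sum_mono2 finite_words F) auto
    also have "\<dots> \<le> q ^ K \<eta>" by (rule sums[OF F])
    also have "\<dots> \<le> \<eta>" by (rule K[OF \<eta>])
    finally show "(\<Sum>w\<in>X. block_product l n (K \<eta>) w powr t) \<le> \<eta>" .
  qed
qed

section \<open>Continuity of the dimension at the unperturbed system\<close>

lemma countable_E_star: "countable E_star"
proof -
  have "E_star \<subseteq> range (\<lambda>(m::int, n::int). Complex (of_int m) (of_int n))"
    by (auto simp: E_star_def)
  thus ?thesis by (rule countable_subset) simp
qed

lemma word_sum_le_of_null:
  assumes "E \<subseteq> E_star" "0 < s" "hausdorff_measure s (limit_set cf_map E) = 0"
    and F: "finite F" "F \<subseteq> E"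
  shows "word_sum F n s \<le> 4 powr s"
proof -
  have "limit_set cf_map F \<subseteq> limit_set cf_map E"
    using F by (auto simp: limit_set_def seqs_def)
  hence "hausdorff_measure s (limit_set cf_map F) = 0"
    using assms(3) by (rule hausdorff_measure_zero_mono)
  then obtain C where "\<And>n. word_sum F n s \<le> C"
    using word_sum_bounded_of_null[of F s] F assms by blast
  thus ?thesis using F assms by (intro bounded_word_sum_le[of F s C]) auto
qed

text \<open>
  The half of Bowen's formula that compares with the Hausdorff dimension from below: the universal
  bound at exponent \<open>s\<close> makes the sums at any larger exponent decay exponentially, so the
  pressure is negative there.
\<close>
lemma pressure_zero_le_of_null:
  assumes E: "E \<subseteq> E_star" and s: "0 < s" "hausdorff_measure s (limit_set cf_map E) = 0"
    and pressure: "has_pressure E (\<lambda>\<omega>. s\<^sub>0 * cf_potential \<omega>) 0" and "0 \<le> s\<^sub>0"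
  shows "s\<^sub>0 \<le> s"
proof (rule ccontr)
  assume less: "\<not> s\<^sub>0 \<le> s"
  have "partition_sum E (\<lambda>\<omega>. s\<^sub>0 * cf_potential \<omega>) n
          \<le> ennreal (4 powr s * ((1/2) ^ (n div 2)) powr (s\<^sub>0 - s))" for n
  proof (rule partition_sum_le[OF E \<open>0 \<le> s\<^sub>0\<close>])
    fix F assume F: "finite F" "F \<subseteq> E"
    have "word_sum F n s\<^sub>0 \<le> ((1/2) ^ (n div 2)) powr (s\<^sub>0 - s) * word_sum F n s"
      using F E less by (intro word_sum_decay) auto
    also have "\<dots> \<le> ((1/2) ^ (n div 2)) powr (s\<^sub>0 - s) * 4 powr s"
      using word_sum_le_of_null[OF E s F] by (intro mult_left_mono) auto
    finally show "word_sum F n s\<^sub>0 \<le> 4 powr s * ((1/2) ^ (n div 2)) powr (s\<^sub>0 - s)"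
      by (simp add: mult.commute)
  qed
  from pressure_negative_if_exponential_decay[OF pressure _ _ this] less show False by simp
qed

text \<open>
  The length \<open>n\<close> is chosen before \<open>\<epsilon>\<close>: the unperturbed words of length \<open>n\<close> already have a small sum
  at exponent \<open>t\<close>, and all others together contribute at most \<open>\<epsilon> powr t * C ^ n\<close>, which tends to 0
  for fixed \<open>n\<close>.
\<close>
lemma perturbed_limit_set_eventually_null:
  assumes Ehat: "Ehat \<subseteq> E_star" and "E \<subseteq> Ehat"
    and s: "0 < s" "hausdorff_measure s (limit_set cf_map E) = 0" and t: "s < t"
    and C: "\<And>F. finite F \<Longrightarrow> F \<subseteq> Ehat \<Longrightarrow> (\<Sum>e\<in>F. cf_sup [e] powr t) \<le> C"
  shows "\<forall>\<^sub>F \<epsilon> in at_right 0. hausdorff_measure t (limit_set (cf_perturbed E \<epsilon>) Ehat) = 0"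
proof -
  have E: "E \<subseteq> E_star" using assms by auto
  have C0: "0 \<le> C" using C[of "{}"] by simp
  have "(1/2::real) powr (t - s) < 1"
    using t powr_less_mono2[of "t - s" "1/2" 1] by simp
  then obtain m where m: "((1/2) powr (t - s)) ^ m < 1 / (2 * 4 powr s)"
    using real_arch_pow_inv[of "1 / (2 * 4 powr s)" "(1/2) powr (t - s)"] by auto
  \<comment> \<open>one factor 1/2 for every two symbols\<close>
  define n where "n = 2 * m"
  have unperturbed: "word_sum F n t \<le> 1/2" if F: "finite F" "F \<subseteq> E" for F
  proof -
    have "word_sum F n t \<le> ((1/2) ^ m) powr (t - s) * word_sum F n s"
      using word_sum_decay[of F s t n] F E t by (auto simp: n_def)
    also have "\<dots> \<le> ((1/2) ^ m) powr (t - s) * 4 powr s"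
      using word_sum_le_of_null[OF E s F] by (intro mult_left_mono) auto
    also have "((1/2::real) ^ m) powr (t - s) = ((1/2) powr (t - s)) ^ m"
    proof -
      have "((1/2::real) ^ m) powr (t - s) = ((1/2) powr real m) powr (t - s)"
        by (subst powr_realpow) auto
      also have "\<dots> = ((1/2) powr (t - s)) powr real m"
        by (simp only: powr_powr mult.commute)
      also have "\<dots> = ((1/2) powr (t - s)) ^ m" by (rule powr_realpow) simp
      finally show ?thesis .
    qed
    also have "\<dots> * 4 powr s \<le> 1 / (2 * 4 powr s) * 4 powr s"
      using m by (intro mult_right_mono) auto
    finally show ?thesis by simp
  qed
  define \<delta> where "\<delta> = min (1/2) ((1 / (4 * (C ^ n + 1))) powr (1/t))"
  have Cn: "0 < 4 * (C ^ n + 1)" using C0 by (simp add: add_nonneg_pos)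
  have \<delta>: "0 < \<delta>" using Cn by (simp add: \<delta>_def)
  have "hausdorff_measure t (limit_set (cf_perturbed E \<epsilon>) Ehat) = 0" if \<epsilon>: "\<epsilon> \<in> {0<..<\<delta>}" for \<epsilon>
  proof (rule limit_set_null[where l = "perturbed_rate E \<epsilon>" and q = "3/4" and n = n])
    have \<epsilon>': "0 < \<epsilon>" "\<epsilon> \<le> 1/2" "\<epsilon> \<le> 1" using \<epsilon> by (auto simp: \<delta>_def)
    show "contractive (cf_perturbed E \<epsilon>) Ehat"
      using contractive_subset[OF contractive_cf_perturbed[OF \<epsilon>'(1,2)] Ehat] .
    show "countable Ehat" by (rule countable_subset[OF Ehat countable_E_star])
    show "0 < t" using s t by simp
    show "0 \<le> perturbed_rate E \<epsilon> w" if "w \<in> words Ehat n" for w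
      using words_set[OF that] Ehat \<epsilon>' by (intro perturbed_rate_nonneg) auto
    show "cmod (word_map (cf_perturbed E \<epsilon>) w x - word_map (cf_perturbed E \<epsilon>) w y)
            \<le> perturbed_rate E \<epsilon> w * cmod (x - y)"
      if "w \<in> words Ehat n" "x \<in> disk" "y \<in> disk" for w x y
      using words_set[OF that(1)] Ehat \<epsilon>' that by (intro perturbed_word_lipschitz) auto
    fix F assume F: "finite F" "F \<subseteq> Ehat"
    have "\<epsilon> powr t \<le> ((1 / (4 * (C ^ n + 1))) powr (1/t)) powr t"
      using \<epsilon> s t by (intro powr_mono2) (auto simp: \<delta>_def)
    also have "\<dots> = 1 / (4 * (C ^ n + 1))" using s t Cn by (simp add: powr_powr)
    finally have "\<epsilon> powr t * (\<Sum>e\<in>F. cf_sup [e] powr t) ^ n \<le> 1 / (4 * (C ^ n + 1)) * C ^ n"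
      using C[OF F] Cn by (intro mult_mono power_mono) (auto intro!: sum_nonneg zero_le_power)
    also have "\<dots> \<le> 1/4" using Cn C0 by (simp add: field_simps)
    finally have "\<epsilon> powr t * (\<Sum>e\<in>F. cf_sup [e] powr t) ^ n \<le> 1/4" .
    moreover have "word_sum (F \<inter> E) n t \<le> 1/2" using F by (intro unperturbed) auto
    moreover have "(\<Sum>w\<in>words F n. perturbed_rate E \<epsilon> w powr t)
           \<le> word_sum (F \<inter> E) n t + \<epsilon> powr t * (\<Sum>e\<in>F. cf_sup [e] powr t) ^ n"
      using F Ehat s t \<epsilon>' by (intro perturbed_word_sum_le) auto
    ultimately show "(\<Sum>w\<in>words F n. perturbed_rate E \<epsilon> w powr t) \<le> 3/4" by linarith
  qed auto
  with eventually_at_right_real[OF \<delta>] show ?thesis by (rule eventually_mono)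
qed

theorem theorem4p3:
  fixes E Ehat :: "complex set" and s\<^sub>0 :: real
  assumes "Ehat \<subseteq> E_star" and "Ehat \<noteq> {}"
    and "E \<subseteq> Ehat"
    and "hausdorff_dim (limit_set cf_map E) > 0"
    and "has_pressure E (\<lambda>\<omega>. s\<^sub>0 * cf_potential \<omega>) 0"
    and "s\<^sub>0 \<ge> 0"
    and "(\<lambda>e. cf_deriv_norm e powr s\<^sub>0) summable_on Ehat"
  shows "((\<lambda>\<epsilon>. hausdorff_dim (limit_set (cf_perturbed E \<epsilon>) Ehat))
           \<longlongrightarrow> hausdorff_dim (limit_set cf_map E)) (at_right 0)"
proof (rule order_tendstoI)
  fix a assume "a < hausdorff_dim (limit_set cf_map E)"
  hence "a < hausdorff_dim (limit_set (cf_perturbed E \<epsilon>) Ehat)" for \<epsilon>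
    using hausdorff_dim_mono[OF limit_set_subset_perturbed[OF assms(3)]] by (rule less_le_trans)
  thus "\<forall>\<^sub>F \<epsilon> in at_right 0. a < hausdorff_dim (limit_set (cf_perturbed E \<epsilon>) Ehat)" by simp
next
  fix a assume "hausdorff_dim (limit_set cf_map E) < a"
  then obtain s where s: "0 \<le> s" "hausdorff_measure s (limit_set cf_map E) = 0" "ereal s < a"
    unfolding hausdorff_dim_def INF_less_iff by auto
  \<comment> \<open>positive dimension keeps \<open>s\<close> away from the counting measure\<close>
  have "0 < ereal s" using assms(4) hausdorff_dim_le[OF s(1,2)] by (rule less_le_trans)
  hence s_pos: "0 < s" by simp
  obtain t where t: "ereal s < ereal t" "ereal t < a" using ereal_dense2[OF s(3)] by blast
  \<comment> \<open>the series over all of \<open>Ehat\<close> is only known to converge from \<open>s\<^sub>0\<close> on\<close>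
  have "s\<^sub>0 \<le> s"
    using pressure_zero_le_of_null[OF _ s_pos s(2) assms(5,6)] assms(1,3) by blast
  hence s\<^sub>0t: "s\<^sub>0 \<le> t" using t by simp
  have "(\<Sum>e\<in>F. cf_sup [e] powr t) \<le> infsum (\<lambda>e. cf_deriv_norm e powr s\<^sub>0) Ehat"
    if F: "finite F" "F \<subseteq> Ehat" for F
  proof -
    have "(\<Sum>e\<in>F. cf_sup [e] powr t) \<le> (\<Sum>e\<in>F. cf_deriv_norm e powr s\<^sub>0)"
    proof (rule sum_mono)
      fix e assume "e \<in> F"
      hence e: "e \<in> E_star" using F assms(1) by auto
      show "cf_sup [e] powr t \<le> cf_deriv_norm e powr s\<^sub>0"
        unfolding cf_deriv_norm_eq(1)[OF e] using e s\<^sub>0t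
        by (intro powr_mono' cf_sup_le_1 less_imp_le[OF cf_sup_pos]) auto
    qed
    also have "\<dots> \<le> infsum (\<lambda>e. cf_deriv_norm e powr s\<^sub>0) Ehat"
      by (intro finite_sum_le_infsum assms(7) F) auto
    finally show ?thesis .
  qed
  hence "\<forall>\<^sub>F \<epsilon> in at_right 0. hausdorff_measure t (limit_set (cf_perturbed E \<epsilon>) Ehat) = 0"
    using t by (intro perturbed_limit_set_eventually_null[OF assms(1,3) s_pos s(2)]) auto
  thus "\<forall>\<^sub>F \<epsilon> in at_right 0. hausdorff_dim (limit_set (cf_perturbed E \<epsilon>) Ehat) < a"
  proof eventually_elim
    case (elim \<epsilon>)
    have "hausdorff_dim (limit_set (cf_perturbed E \<epsilon>) Ehat) \<le> ereal t"
      using elim s_pos t by (intro hausdorff_dim_le) auto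
    thus ?case using t(2) by (rule le_less_trans)
  qed
qed

end
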